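(* Let the constant parameters satisfy $6\alpha_0+5\alpha_1+4\alpha_2+3\alpha_3+2\alpha_4+\alpha_5+4\alpha_6+2\alpha_7+3\alpha_8=0$ and consider the system $\frac{dq}{dt}=\frac{\partial I}{\partial p}$, $\frac{dp}{dt}=-\frac{\partial I}{\partial q}$ with the Hamiltonian $I$ given in the context. This system admits the affine Weyl group symmetry of type $E_8^{(1)}$ as the group of its Bäcklund transformations, with generators $s_0,\dots,s_8$ given, with the notation $( * )=(q,p,t;\alpha_0,\alpha_1,\dots,\alpha_8)$, by $$\begin{aligned} s_0:( * )&\to\left(q+\tfrac{\alpha_0}{p},p,t;-\alpha_0,\alpha_1+\alpha_0,\alpha_2,\alpha_3,\alpha_4,\alpha_5,\alpha_6+\alpha_0,\alpha_7,\alpha_8+\alpha_0\right),\\ s_1:( * )&\to\left(q,p-\tfrac{\alpha_1}{q},t;\alpha_0+\alpha_1,-\alpha_1,\alpha_2+\alpha_1,\alpha_3,\alpha_4,\alpha_5,\alpha_6,\alpha_7,\alpha_8\right),\\ s_2:( * )&\to(q,p,t;\alpha_0,\alpha_1+\alpha_2,-\alpha_2,\alpha_3+\alpha_2,\alpha_4,\alpha_5,\alpha_6,\alpha_7,\alpha_8),\\ s_3:( * )&\to(q,p,t;\alpha_0,\alpha_1,\alpha_2+\alpha_3,-\alpha_3,\alpha_4+\alpha_3,\alpha_5,\alpha_6,\alpha_7,\alpha_8),\\ s_4:( * )&\to(q,p,t;\alpha_0,\alpha_1,\alpha_2,\alpha_3+\alpha_4,-\alpha_4,\alpha_5+\alpha_4,\alpha_6,\alpha_7,\alpha_8),\\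 s_5:( * )&\to(q,p,t;\alpha_0,\alpha_1,\alpha_2,\alpha_3,\alpha_4+\alpha_5,-\alpha_5,\alpha_6,\alpha_7,\alpha_8),\\ s_6:( * )&\to\left(q,p-\tfrac{\alpha_6}{q-1},t;\alpha_0+\alpha_6,\alpha_1,\alpha_2,\alpha_3,\alpha_4,\alpha_5,-\alpha_6,\alpha_7+\alpha_6,\alpha_8\right),\\ s_7:( * )&\to(q,p,t;\alpha_0,\alpha_1,\alpha_2,\alpha_3,\alpha_4,\alpha_5,\alpha_6+\alpha_7,-\alpha_7,\alpha_8),\\ s_8:( * )&\to(q,p,t;\alpha_0+\alpha_8,\alpha_1,\alpha_2,\alpha_3,\alpha_4,\alpha_5,\alpha_6,\alpha_7,-\alpha_8). \end{aligned}$$ That is, each $s_i$ is a Bäcklund transformation of the system, and $s_0,\dots,s_8$ satisfy the defining relations of, and realize, the affine Weyl group $W(E_8^{(1)})$.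
   Context: The Hamiltonian is $$\begin{aligned} I={}&q^5(q-1)^4p^6+q^4(q-1)^3(3\kappa q+\beta_1)p^5+q^3(q-1)^2\{3(\kappa^2+\varepsilon)q^2+mq+\beta_2\}p^4\\ &+q^2(q-1)\{A_3q^3+xq^2-(A_3+x+\beta_3+2\gamma_1\gamma_2)q+\beta_3\}p^3\\ &+q\{A_2q^4+B_2q^3+C_2q^2+(\gamma_2^2-A_2-B_2-C_2-\beta_4)q+\beta_4\}p^2\\ &+\{3\kappa\varepsilon^2q^4+B_1q^3+C_1q^2+G_1q-\beta_5\}p+\varepsilon^3q^3+\varepsilon^2b_0q^2+\varepsilon c_0q, \end{aligned}$$ where $\kappa=2\alpha_0+\alpha_8$, $\varepsilon=\alpha_0(\alpha_0+\alpha_8)$, $\gamma_1=2\alpha_6+\alpha_7$, $\gamma_2=\alpha_6(\alpha_6+\alpha_7)$; $\beta_1,\dots,\beta_5$ are the elementary symmetric functions (of degree $1,\dots,5$) of the five numbers $\rho_k=\alpha_1+\cdots+\alpha_k$, $k=1,\dots,5$; and $$\begin{aligned} v&=\gamma_1^2+2\gamma_2-\beta_2,\qquad m=v-3(\kappa^2+\varepsilon),\qquad b_0=v+4\kappa\gamma_1+3\kappa^2-\varepsilon,\\ A_3&=\kappa^3+6\kappa\varepsilon,\qquad x=2\kappa v+3\kappa^3-12\kappa\varepsilon+6\kappa^2\gamma_1-4\varepsilon\gamma_1,\\ k_0&=\gamma_1^3+5\kappa\gamma_1^2+\kappa\gamma_2+9\kappa^2\gamma_1-\varepsilon\gamma_1+5\kappa^3-(\gamma_1+2\kappa)\beta_2-\beta_3,\\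 A_2&=3\kappa^2\varepsilon+3\varepsilon^2,\\ B_2&=(\kappa^2+2\varepsilon)v+4\kappa^3\gamma_1+4\kappa\varepsilon\gamma_1+3\kappa^4-3\kappa^2\varepsilon-6\varepsilon^2,\\ C_2&=\beta_4-3A_2-2B_2+\gamma_2(\gamma_1^2+\gamma_2+3\kappa\gamma_1+3\kappa^2+3\varepsilon-\beta_2)-\gamma_1k_0,\\ c_2&=-2\gamma_1^2-4\gamma_2+3\beta_2-3\kappa^2+3\varepsilon-6\kappa\gamma_1,\\ c_1&=-2\gamma_1\gamma_2-4\kappa^3+3\kappa\varepsilon-2\kappa\gamma_1^2-4\kappa\gamma_2+\kappa\beta_2-6\kappa^2\gamma_1+2\varepsilon\gamma_1-\beta_3,\\ c_0&=C_2-\kappa c_1-\varepsilon c_2,\\ B_1&=2\kappa\varepsilon b_0-2\varepsilon^2(2\kappa+\gamma_1),\qquad C_1=\kappa c_0+\varepsilon c_1,\\ G_1&=\gamma_2k_0+\beta_5-3\kappa\varepsilon^2-B_1-C_1 . \end{aligned}$$ The list of transformations is read as follows: $s_i$ is the automorphism of the field of rational functions in $q,p,t$ and the $\alpha_j$ (subject to the linear relation) sending each entry of $( * )$ to the corresponding entry on the right; e.g. $s_0(q)=q+\alpha_0/p$, $s_0(p)=p$, $s_0(t)=t$, $s_0(\alpha_0)=-\alpha_0$, $s_0(\alpha_1)=\alpha_1+\alpha_0$. Such $w$ is a Bäcklund transformation of the system if, whenever $(q,p)$ satisfies the system, $(Q,P)=(w(q),w(p))$ satisfies the same system with time variable $w(t)$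 and parameters $w(\alpha_j)$ (as an identity of rational functions). The Dynkin diagram of type $E_8^{(1)}$ has nodes $0,\dots,8$ and edges $0\!-\!1$, $1\!-\!2$, $2\!-\!3$, $3\!-\!4$, $4\!-\!5$, $0\!-\!6$, $6\!-\!7$, $0\!-\!8$. The group $W(E_8^{(1)})$ is defined by generators $s_0,\dots,s_8$ and relations $s_i^2=1$, $(s_is_j)^3=1$ if $i,j$ are joined by an edge, $(s_is_j)^2=1$ if $i\ne j$ are not joined. *)

theory Defs
  imports
    Complex_Main
    "HOL-Library.Poly_Mapping"
    "HOL-Computational_Algebra.Fraction_Field"
    "HOL-Algebra.Elementary_Groups"
begin

section \<open>The Hamiltonian\<close>

text \<open>All coefficients are polynomials in the parameters, so they are defined over an arbitrary
  commutative ring. The names follow the paper, except for \<open>vI\<close>, \<open>mI\<close>, \<open>xI\<close>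
  (there \<open>v\<close>, \<open>m\<close>, \<open>x\<close>).\<close>

context
  fixes \<alpha> :: "nat \<Rightarrow> 'a::comm_ring_1"
begin

definition "\<kappa> = 2 * \<alpha> 0 + \<alpha> 8"
definition "\<epsilon> = \<alpha> 0 * (\<alpha> 0 + \<alpha> 8)"
definition "\<gamma>1 = 2 * \<alpha> 6 + \<alpha> 7"
definition "\<gamma>2 = \<alpha> 6 * (\<alpha> 6 + \<alpha> 7)"
definition "\<rho> k = (\<Sum>j=1..k. \<alpha> j)"

text \<open>The elementary symmetric function of degree \<open>n\<close> of \<open>\<rho> 1, \<dots>, \<rho> 5\<close>.\<close>

definition "\<beta> (n::nat) = (\<Sum>S | S \<subseteq> {1..5} \<and> card S = n. \<Prod>k\<in>S. \<rho> k)"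

definition "vI = \<gamma>1^2 + 2*\<gamma>2 - \<beta> 2"
definition "mI = vI - 3*(\<kappa>^2 + \<epsilon>)"
definition "b0 = vI + 4*\<kappa>*\<gamma>1 + 3*\<kappa>^2 - \<epsilon>"
definition "A3 = \<kappa>^3 + 6*\<kappa>*\<epsilon>"
definition "xI = 2*\<kappa>*vI + 3*\<kappa>^3 - 12*\<kappa>*\<epsilon> + 6*\<kappa>^2*\<gamma>1 - 4*\<epsilon>*\<gamma>1"
definition "k0 = \<gamma>1^3 + 5*\<kappa>*\<gamma>1^2 + \<kappa>*\<gamma>2 + 9*\<kappa>^2*\<gamma>1 - \<epsilon>*\<gamma>1 + 5*\<kappa>^3
  - (\<gamma>1 + 2*\<kappa>)*\<beta> 2 - \<beta> 3"
definition "A2 = 3*\<kappa>^2*\<epsilon> + 3*\<epsilon>^2"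
definition "B2 = (\<kappa>^2 + 2*\<epsilon>)*vI + 4*\<kappa>^3*\<gamma>1 + 4*\<kappa>*\<epsilon>*\<gamma>1 + 3*\<kappa>^4 - 3*\<kappa>^2*\<epsilon> - 6*\<epsilon>^2"
definition "C2 = \<beta> 4 - 3*A2 - 2*B2
  + \<gamma>2*(\<gamma>1^2 + \<gamma>2 + 3*\<kappa>*\<gamma>1 + 3*\<kappa>^2 + 3*\<epsilon> - \<beta> 2) - \<gamma>1*k0"
definition "c2 = - 2*\<gamma>1^2 - 4*\<gamma>2 + 3*\<beta> 2 - 3*\<kappa>^2 + 3*\<epsilon> - 6*\<kappa>*\<gamma>1"
definition "c1 = - 2*\<gamma>1*\<gamma>2 - 4*\<kappa>^3 + 3*\<kappa>*\<epsilon> - 2*\<kappa>*\<gamma>1^2 - 4*\<kappa>*\<gamma>2 + \<kappa>*\<beta> 2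
  - 6*\<kappa>^2*\<gamma>1 + 2*\<epsilon>*\<gamma>1 - \<beta> 3"
definition "c0 = C2 - \<kappa>*c1 - \<epsilon>*c2"
definition "B1 = 2*\<kappa>*\<epsilon>*b0 - 2*\<epsilon>^2*(2*\<kappa> + \<gamma>1)"
definition "C1 = \<kappa>*c0 + \<epsilon>*c1"
definition "G1 = \<gamma>2*k0 + \<beta> 5 - 3*\<kappa>*\<epsilon>^2 - B1 - C1"

definition ham :: "'a \<Rightarrow> 'a \<Rightarrow> 'a" where
  "ham q p =
     q^5*(q-1)^4*p^6
   + q^4*(q-1)^3*(3*\<kappa>*q + \<beta> 1)*p^5
   + q^3*(q-1)^2*(3*(\<kappa>^2 + \<epsilon>)*q^2 + mI*q + \<beta> 2)*p^4
   + q^2*(q-1)*(A3*q^3 + xI*q^2 - (A3 + xI + \<beta> 3 + 2*\<gamma>1*\<gamma>2)*q + \<beta> 3)*p^3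
   + q*(A2*q^4 + B2*q^3 + C2*q^2 + (\<gamma>2^2 - A2 - B2 - C2 - \<beta> 4)*q + \<beta> 4)*p^2
   + (3*\<kappa>*\<epsilon>^2*q^4 + B1*q^3 + C1*q^2 + G1*q - \<beta> 5)*p
   + \<epsilon>^3*q^3 + \<epsilon>^2*b0*q^2 + \<epsilon>*c0*q"

end

section \<open>The field of rational functions\<close>

text \<open>The linear relation has coefficient 1 at \<open>\<alpha>\<^sub>5\<close>. So the polynomial ring in
  \<open>q, p, t, \<alpha>\<^sub>0, \<dots>, \<alpha>\<^sub>8\<close> modulo the relation is the polynomial ring in these
  variables without \<open>\<alpha>\<^sub>5\<close>, and \<open>\<alpha>\<^sub>5\<close> becomes the linear form determined by
  the relation.\<close>

datatype var = Vq | Vp | Vt | Va0 | Va1 | Va2 | Va3 | Va4 | Va6 | Va7 | Va8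

text \<open>The order on the variables has no mathematical meaning; the library asks for it in order to
  prove that the polynomial ring below is an integral domain.\<close>

fun var_index :: "var \<Rightarrow> nat" where
  "var_index Vq = 0" | "var_index Vp = 1" | "var_index Vt = 2"
| "var_index Va0 = 3" | "var_index Va1 = 4" | "var_index Va2 = 5" | "var_index Va3 = 6"
| "var_index Va4 = 7" | "var_index Va6 = 8" | "var_index Va7 = 9" | "var_index Va8 = 10"

instantiation var :: linorder
begin
definition "x \<le> y \<longleftrightarrow> var_index x \<le> var_index y"
definition "x < y \<longleftrightarrow> var_index x < var_index y"
instance
proof
  fix x y :: var
  show "x \<le> y \<Longrightarrow> y \<le> x \<Longrightarrow> x = y"
    by (cases x; cases y) (simp_all add: less_eq_var_def)
qed (auto simp: less_eq_var_def less_var_def)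
end

type_synonym mpoly = "(var \<Rightarrow>\<^sub>0 nat) \<Rightarrow>\<^sub>0 complex"
type_synonym ratfun = "mpoly fract"

definition const :: "complex \<Rightarrow> ratfun" where
  "const c = Fract (Poly_Mapping.single 0 c) 1"

definition X :: "var \<Rightarrow> ratfun" where
  "X v = Fract (Poly_Mapping.single (Poly_Mapping.single v 1) 1) 1"

definition par :: "nat \<Rightarrow> ratfun" where
  "par j = [X Va0, X Va1, X Va2, X Va3, X Va4,
     - (6 * X Va0 + 5 * X Va1 + 4 * X Va2 + 3 * X Va3 + 2 * X Va4
        + 4 * X Va6 + 2 * X Va7 + 3 * X Va8),
     X Va6, X Va7, X Va8] ! j"

lemma par_relation:
  "6 * par 0 + 5 * par 1 + 4 * par 2 + 3 * par 3 + 2 * par 4 + par 5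
   + 4 * par 6 + 2 * par 7 + 3 * par 8 = 0"
  by (simp add: par_def)

definition automorphism :: "(ratfun \<Rightarrow> ratfun) \<Rightarrow> bool" where
  "automorphism w \<longleftrightarrow> bij w \<and> (\<forall>c. w (const c) = const c) \<and>
     (\<forall>f g. w (f + g) = w f + w g) \<and> (\<forall>f g. w (f * g) = w f * w g)"

definition Aut :: "(ratfun \<Rightarrow> ratfun) monoid" where
  "Aut = \<lparr>carrier = {w. automorphism w}, monoid.mult = (\<circ>), one = id\<rparr>"

section \<open>The system and its Baecklund transformations\<close>

definition derivation :: "(ratfun \<Rightarrow> ratfun) \<Rightarrow> bool" where
  "derivation d \<longleftrightarrow> (\<forall>c. d (const c) = 0) \<and>
     (\<forall>f g. d (f + g) = d f + d g) \<and> (\<forall>f g. d (f * g) = d f * g + f * d g)"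

text \<open>The partial derivative \<open>\<partial>f/\<partial>v\<close>, characterised as the unique derivation over the complex numbers
  that takes the value 1 at \<open>v\<close> and 0 at all other variables.\<close>

definition partial :: "var \<Rightarrow> ratfun \<Rightarrow> ratfun" where
  "partial v = (THE d. derivation d \<and> (\<forall>u. d (X u) = (if u = v then 1 else 0)))"

definition I :: ratfun where
  "I = ham par (X Vq) (X Vp)"

text \<open>The derivative \<open>df/dt\<close> of a rational function \<open>f\<close> along the solutions of
  \<open>dq/dt = \<partial>I/\<partial>p\<close>, \<open>dp/dt = - \<partial>I/\<partial>q\<close>, the parameters being constant.\<close>

definition ddt :: "ratfun \<Rightarrow> ratfun" where
  "ddt f = partial Vq f * partial Vp I - partial Vp f * partial Vq I + partial Vt f"

text \<open>The system for \<open>Q = w q\<close>, \<open>P = w p\<close> with time variable \<open>w t\<close> and constant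
  parameters \<open>w \<alpha>\<^sub>j\<close>. Its right hand sides arise from \<open>\<partial>I/\<partial>p\<close> and \<open>- \<partial>I/\<partial>q\<close>
  by replacing \<open>q, p, \<alpha>\<^sub>j\<close> by \<open>w q, w p, w \<alpha>\<^sub>j\<close>; as \<open>w\<close> is a field automorphism over the
  complex numbers, this is the application of \<open>w\<close>.\<close>

definition baecklund :: "(ratfun \<Rightarrow> ratfun) \<Rightarrow> bool" where
  "baecklund w \<longleftrightarrow> automorphism w \<and>
     (\<forall>j\<le>8. ddt (w (par j)) = 0) \<and>
     ddt (w (X Vt)) \<noteq> 0 \<and>
     ddt (w (X Vq)) / ddt (w (X Vt)) = w (partial Vp I) \<and>
     ddt (w (X Vp)) / ddt (w (X Vt)) = w (- partial Vq I)"

section \<open>The transformations\<close>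

definition tuple :: "ratfun list" where
  "tuple = [X Vq, X Vp, X Vt, par 0, par 1, par 2, par 3, par 4, par 5, par 6, par 7, par 8]"

definition images :: "ratfun \<Rightarrow> ratfun \<Rightarrow> ratfun \<Rightarrow> (nat \<Rightarrow> ratfun) \<Rightarrow> ratfun list list" where
  "images q p t \<alpha> =
   [[q + \<alpha> 0 / p, p, t, - \<alpha> 0, \<alpha> 1 + \<alpha> 0, \<alpha> 2, \<alpha> 3, \<alpha> 4, \<alpha> 5, \<alpha> 6 + \<alpha> 0, \<alpha> 7, \<alpha> 8 + \<alpha> 0],
    [q, p - \<alpha> 1 / q, t, \<alpha> 0 + \<alpha> 1, - \<alpha> 1, \<alpha> 2 + \<alpha> 1, \<alpha> 3, \<alpha> 4, \<alpha> 5, \<alpha> 6, \<alpha> 7, \<alpha> 8],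
    [q, p, t, \<alpha> 0, \<alpha> 1 + \<alpha> 2, - \<alpha> 2, \<alpha> 3 + \<alpha> 2, \<alpha> 4, \<alpha> 5, \<alpha> 6, \<alpha> 7, \<alpha> 8],
    [q, p, t, \<alpha> 0, \<alpha> 1, \<alpha> 2 + \<alpha> 3, - \<alpha> 3, \<alpha> 4 + \<alpha> 3, \<alpha> 5, \<alpha> 6, \<alpha> 7, \<alpha> 8],
    [q, p, t, \<alpha> 0, \<alpha> 1, \<alpha> 2, \<alpha> 3 + \<alpha> 4, - \<alpha> 4, \<alpha> 5 + \<alpha> 4, \<alpha> 6, \<alpha> 7, \<alpha> 8],
    [q, p, t, \<alpha> 0, \<alpha> 1, \<alpha> 2, \<alpha> 3, \<alpha> 4 + \<alpha> 5, - \<alpha> 5, \<alpha> 6, \<alpha> 7, \<alpha> 8],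
    [q, p - \<alpha> 6 / (q - 1), t, \<alpha> 0 + \<alpha> 6, \<alpha> 1, \<alpha> 2, \<alpha> 3, \<alpha> 4, \<alpha> 5, - \<alpha> 6, \<alpha> 7 + \<alpha> 6, \<alpha> 8],
    [q, p, t, \<alpha> 0, \<alpha> 1, \<alpha> 2, \<alpha> 3, \<alpha> 4, \<alpha> 5, \<alpha> 6 + \<alpha> 7, - \<alpha> 7, \<alpha> 8],
    [q, p, t, \<alpha> 0 + \<alpha> 8, \<alpha> 1, \<alpha> 2, \<alpha> 3, \<alpha> 4, \<alpha> 5, \<alpha> 6, \<alpha> 7, - \<alpha> 8]]"

definition acts_as_listed :: "nat \<Rightarrow> (ratfun \<Rightarrow> ratfun) \<Rightarrow> bool" where
  "acts_as_listed i w \<longleftrightarrow>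
     automorphism w \<and> map w tuple = images (X Vq) (X Vp) (X Vt) par ! i"

definition s :: "nat \<Rightarrow> ratfun \<Rightarrow> ratfun" where
  "s i = (THE w. acts_as_listed i w)"

section \<open>Groups given by generators and relations\<close>

text \<open>A word is a list of letters \<open>(x, True)\<close> and \<open>(x, False)\<close>, which stand for the generator
  \<open>x\<close> and for its inverse.\<close>

definition words :: "'g set \<Rightarrow> ('g \<times> bool) list set" where
  "words S = lists (S \<times> UNIV)"

inductive_set word_rel ::
    "'g set \<Rightarrow> ('g \<times> bool) list set \<Rightarrow> (('g \<times> bool) list \<times> ('g \<times> bool) list) set"
  for S R where
  relator: "r \<in> R \<Longrightarrow> (r, []) \<in> word_rel S R"
| cancel: "x \<in> S \<Longrightarrow> ([(x, b), (x, \<not> b)], []) \<in> word_rel S R"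
| refl: "u \<in> words S \<Longrightarrow> (u, u) \<in> word_rel S R"
| sym: "(u, v) \<in> word_rel S R \<Longrightarrow> (v, u) \<in> word_rel S R"
| trans: "(u, v) \<in> word_rel S R \<Longrightarrow> (v, w) \<in> word_rel S R \<Longrightarrow> (u, w) \<in> word_rel S R"
| append: "(u, v) \<in> word_rel S R \<Longrightarrow> (u', v') \<in> word_rel S R \<Longrightarrow>
    (u @ u', v @ v') \<in> word_rel S R"

text \<open>The relators in \<open>R\<close> are required to be words in the generators \<open>S\<close>.\<close>

definition presented_group ::
    "'g set \<Rightarrow> ('g \<times> bool) list set \<Rightarrow> ('g \<times> bool) list set monoid" where
  "presented_group S R =
    \<lparr>carrier = words S // word_rel S R,
     monoid.mult = (\<lambda>U V. word_rel S R `` {u @ v | u v. u \<in> U \<and> v \<in> V}),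
     one = word_rel S R `` {[]}\<rparr>"

definition E8_edges :: "nat set set" where
  "E8_edges = {{0,1}, {1,2}, {2,3}, {3,4}, {4,5}, {0,6}, {6,7}, {0,8}}"

definition E8_relators :: "(nat \<times> bool) list set" where
  "E8_relators =
     {[(i, True), (i, True)] | i. i \<le> 8} \<union>
     {concat (replicate 3 [(i, True), (j, True)]) | i j.
        i \<le> 8 \<and> j \<le> 8 \<and> {i, j} \<in> E8_edges} \<union>
     {concat (replicate 2 [(i, True), (j, True)]) | i j.
        i \<le> 8 \<and> j \<le> 8 \<and> i \<noteq> j \<and> {i, j} \<notin> E8_edges}"

definition W_E8 :: "(nat \<times> bool) list set monoid" where
  "W_E8 = presented_group {..8} E8_relators"

definition W_gen :: "nat \<Rightarrow> (nat \<times> bool) list set" where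
  "W_gen i = word_rel {..8} E8_relators `` {[(i, True)]}"

end

theory Submission
  imports Defs "HOL-Computational_Algebra.Formal_Laurent_Series"
begin

text \<open>Each \<open>s\<^sub>i\<close> is a canonical transformation of \<open>(q, p)\<close> that changes the Hamiltonian only by a
  function of the parameters, so it commutes with \<open>d/dt\<close>.

  The relations are checked on generators. That there are no others needs more than the action on
  the parameters: as the null root \<open>\<delta>\<close> is 0 there, the translations of the affine Weyl group act
  trivially on them. Replace the parameters \<open>\<alpha>\<close> by \<open>\<alpha> z\<close> and expand at \<open>z = 0\<close>. Then
  \<open>w q = q + (w \<Lambda> - \<Lambda>) z / p + O(z\<^sup>2)\<close> for a weight \<open>\<Lambda>\<close> with
  \<open>s\<^sub>i \<Lambda> = \<Lambda>\<close> for \<open>i \<noteq> 0\<close> and \<open>s\<^sub>0 \<Lambda> = \<Lambda> + \<alpha>\<^sub>0\<close>. So if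
  \<open>w\<close> acts as the identity, then \<open>w \<Lambda> - \<Lambda>\<close> and all \<open>w \<alpha>\<^sub>j - \<alpha>\<^sub>j\<close> are multiples of \<open>\<delta>\<close>. By the invariance of the
  bilinear form \<open>w\<close> then fixes every \<open>\<alpha>\<^sub>j\<close>, and \<open>w = 1\<close> in the Coxeter group because the
  reflection representation is faithful (a theorem of Tits): if \<open>l(w s\<^sub>i) \<ge> l(w)\<close>, then
  \<open>w \<alpha>\<^sub>i\<close> has nonnegative coefficients.\<close>

section \<open>Morphisms\<close>

text \<open>The shape of the Hamiltonian comes from the three legs of the diagram. At q = 0, q = 1
  and q = infinity its extreme coefficients, as polynomials in q p or (q - 1) p, have six simple
  roots 0 and \<open>\<rho> k\<close>, three double roots 0, \<open>\<alpha> 6\<close>,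
  \<open>\<alpha> 6 + \<alpha> 7\<close>, and two triple roots \<open>- \<alpha> 0\<close>,
  \<open>- \<alpha> 0 - \<alpha> 8\<close>. The reflections that fix q and p only swap two of these
  roots; for the nodes 0, 1 and 6 the roots are also shifted, and the change of q or p compensates
  the shift. A substitution of rational functions for the variables extends to the field only if it
  sends no nonzero polynomial to 0. For the generators this follows from their being involutions,
  for power series expansions from evaluating the expansion variable at a point where the original
  variables reappear.\<close>

locale ring_morphism =
  fixes f :: "'a::comm_ring_1 \<Rightarrow> 'b::comm_ring_1"
  assumes add: "f (x + y) = f x + f y"
    and mult: "f (x * y) = f x * f y"
    and one: "f 1 = 1"
begin

lemma zero: "f 0 = 0"
  using add[of 0 0] by simp

lemma uminus: "f (- x) = - f x"
  using add[of x "- x"] by (simp add: zero eq_neg_iff_add_eq_0 add.commute)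

lemma diff: "f (x - y) = f x - f y"
  using add[of x "- y"] by (simp add: uminus)

lemma power: "f (x ^ n) = f x ^ n"
  by (induction n) (simp_all add: one mult)

lemma of_nat: "f (of_nat n) = of_nat n"
  by (induction n) (simp_all add: zero add one)

lemma numeral: "f (numeral n) = numeral n"
  using of_nat[of "numeral n"] by simp

lemma of_int: "f (of_int n) = of_int n"
  by (cases n rule: int_cases2) (simp_all add: of_nat uminus)

lemma sum: "f (sum g A) = (\<Sum>x\<in>A. f (g x))"
  by (induction A rule: infinite_finite_induct) (simp_all add: zero add)

lemma prod: "f (prod g A) = (\<Prod>x\<in>A. f (g x))"
  by (induction A rule: infinite_finite_induct) (simp_all add: one mult)

lemmas hom_simps = add mult one zero uminus diff power numeral of_int sum prod

end

locale field_morphism = ring_morphism f for f :: "'a::field \<Rightarrow> 'b::field"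
begin

lemma eq_0_iff: "f x = 0 \<longleftrightarrow> x = 0"
proof
  assume "f x = 0"
  show "x = 0"
  proof (rule ccontr)
    assume "x \<noteq> 0"
    then have "f x * f (inverse x) = 1"
      by (simp add: one flip: mult)
    then show False using \<open>f x = 0\<close> by simp
  qed
qed (simp add: zero)

lemma inverse: "f (inverse x) = inverse (f x)"
proof (cases "x = 0")
  case False
  then have "f x * f (inverse x) = 1"
    by (simp add: one flip: mult)
  then show ?thesis by (metis inverse_unique)
qed (simp add: zero)

lemma divide: "f (x / y) = f x / f y"
  by (simp add: divide_inverse mult inverse)

lemmas field_hom_simps = hom_simps divide inverse

end

section \<open>Homomorphisms out of the field of rational functions\<close>

lemma UNIV_var: "(UNIV :: var set) = {Vq, Vp, Vt, Va0, Va1, Va2, Va3, Va4, Va6, Va7, Va8}"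
  using var.exhaust by auto

lemma finite_UNIV_var [simp]: "finite (UNIV :: var set)"
  by (simp add: UNIV_var)

lemma poly_mapping_induct [case_names single add]:
  fixes P :: "('a \<Rightarrow>\<^sub>0 'b::monoid_add) \<Rightarrow> bool"
  assumes single: "\<And>m c. P (Poly_Mapping.single m c)"
    and add: "\<And>f g. P f \<Longrightarrow> P g \<Longrightarrow> P (f + g)"
  shows "P f"
proof (induction f rule: Poly_Mapping.update_induct)
  case const
  show ?case using single[of undefined 0] by simp
next
  case (update f a b)
  have "Poly_Mapping.update a b f = Poly_Mapping.single a b + f"
    using \<open>a \<notin> Poly_Mapping.keys f\<close>
    by (intro poly_mapping_eqI)
      (auto simp: lookup_update lookup_add lookup_single in_keys_iff when_def)
  then show ?case using add single update by simp
qed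

text \<open>The universal map out of the polynomial ring: \<open>k\<close> transports the
  coefficients, \<open>h\<close> the variables.\<close>

definition meval :: "(complex \<Rightarrow> 'r::comm_ring_1) \<Rightarrow> (var \<Rightarrow> 'r) \<Rightarrow> mpoly \<Rightarrow> 'r" where
  "meval k h N = (\<Sum>m\<in>Poly_Mapping.keys N. k (Poly_Mapping.lookup N m) *
     (\<Prod>v\<in>UNIV. h v ^ Poly_Mapping.lookup m v))"

abbreviation pconst :: "complex \<Rightarrow> mpoly" where
  "pconst c \<equiv> Poly_Mapping.single 0 c"

definition pvar :: "var \<Rightarrow> mpoly" where
  "pvar v = Poly_Mapping.single (Poly_Mapping.single v 1) 1"

lemma meval_single:
  "k 0 = 0 \<Longrightarrow> meval k h (Poly_Mapping.single m c)
    = k c * (\<Prod>v\<in>UNIV. h v ^ Poly_Mapping.lookup m v)"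
  by (cases "c = 0") (simp_all add: meval_def)

lemma ring_morphism_meval:
  fixes k :: "complex \<Rightarrow> 'r::comm_ring_1"
  assumes "ring_morphism k"
  shows "ring_morphism (meval k h)" "meval k h (pconst c) = k c" "meval k h (pvar v) = h v"
proof -
  interpret k: ring_morphism k by fact
  note single = meval_single[where k = k, OF k.zero]
  \<comment> \<open>Summing over a common finite set makes additivity termwise; the added terms
    vanish because \<open>k 0 = 0\<close>.\<close>
  have superset: "meval k h N = (\<Sum>m\<in>A. k (Poly_Mapping.lookup N m) *
     (\<Prod>v\<in>UNIV. h v ^ Poly_Mapping.lookup m v))"
    if "Poly_Mapping.keys N \<subseteq> A" "finite A" for N A
    unfolding meval_def using that
    by (intro sum.mono_neutral_left) (auto simp: in_keys_iff k.zero)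
  have plus: "meval k h (M + N) = meval k h M + meval k h N" for M N
    by (subst (1 2 3) superset[of _ "Poly_Mapping.keys M \<union> Poly_Mapping.keys N"])
      (auto simp: lookup_add k.add ring_distribs sum.distrib Poly_Mapping.keys_add
        subsetD[OF Poly_Mapping.keys_add])
  have times_single: "meval k h (Poly_Mapping.single m c * N) =
      meval k h (Poly_Mapping.single m c) * meval k h N" for m c N
    by (induction N rule: poly_mapping_induct)
      (simp_all add: mult_single single k.mult lookup_add power_add prod.distrib
        ring_distribs plus ac_simps)
  have times: "meval k h (M * N) = meval k h M * meval k h N" for M N
    by (induction M rule: poly_mapping_induct) (simp_all add: ring_distribs plus times_single)
  show const: "meval k h (pconst c) = k c" for c
    by (simp add: single)
  show "ring_morphism (meval k h)"
    by unfold_locales (use const[of 1] in \<open>simp_all add: plus times k.one\<close>)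
  have "(\<Prod>u\<in>UNIV. h u ^ Poly_Mapping.lookup (Poly_Mapping.single v (1::nat)) u) =
      (\<Prod>u\<in>UNIV. if u = v then h v else 1)"
    by (intro prod.cong) (auto simp: lookup_single when_def)
  then show "meval k h (pvar v) = h v"
    by (simp add: pvar_def single k.one)
qed

lemma mpoly_induct [case_names const var add mult]:
  fixes P :: "mpoly \<Rightarrow> bool"
  assumes const: "\<And>c. P (pconst c)" and var: "\<And>v. P (pvar v)"
    and add: "\<And>f g. P f \<Longrightarrow> P g \<Longrightarrow> P (f + g)"
    and mult: "\<And>f g. P f \<Longrightarrow> P g \<Longrightarrow> P (f * g)"
  shows "P f"
proof (induction f rule: poly_mapping_induct)
  case (single m c)
  have var_power: "P (Poly_Mapping.single (Poly_Mapping.single v n) 1)" for v n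
  proof (induction n)
    case (Suc n)
    have "Poly_Mapping.single (Poly_Mapping.single v (Suc n)) 1 =
        pvar v * Poly_Mapping.single (Poly_Mapping.single v n) (1::complex)"
      by (simp add: pvar_def mult_single flip: single_add)
    then show ?case using Suc mult var by simp
  qed (use const[of 1] in simp)
  have "P (Poly_Mapping.single m 1)"
  proof (induction m rule: poly_mapping_induct)
    case (add f g)
    then show ?case using mult[of "Poly_Mapping.single f 1" "Poly_Mapping.single g 1"]
      by (simp add: mult_single)
  qed (rule var_power)
  then have "P (pconst c * Poly_Mapping.single m 1)"
    by (rule mult[OF const])
  then show ?case by (simp add: mult_single)
qed (rule add)

definition emb :: "mpoly \<Rightarrow> ratfun" where
  "emb N = Fract N 1"

lemma const_conv_emb: "const c = emb (pconst c)"
  by (simp add: const_def emb_def)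

lemma X_conv_emb: "X v = emb (pvar v)"
  by (simp add: X_def emb_def pvar_def)

interpretation emb: ring_morphism emb
  by unfold_locales (simp_all add: emb_def fract_collapse)

lemma emb_eq_0_iff: "emb N = 0 \<longleftrightarrow> N = 0"
  by (simp add: emb_def Zero_fract_def eq_fract)

interpretation const: ring_morphism const
  unfolding const_def
  by unfold_locales (simp_all add: single_add mult_single fract_collapse)

text \<open>Constants and variables generate the field under sums, products and inverses. This is
  the induction behind \<open>field_morphism_eqI\<close>, \<open>derivation_eqI\<close> and
  \<open>chain_rule\<close>.\<close>

lemma ratfun_induct [case_names const var add mult inverse]:
  assumes const: "\<And>c. P (const c)" and var: "\<And>v. P (X v)"
    and add: "\<And>f g. P f \<Longrightarrow> P g \<Longrightarrow> P (f + g)"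
    and mult: "\<And>f g. P f \<Longrightarrow> P g \<Longrightarrow> P (f * g)"
    and inverse: "\<And>f. P f \<Longrightarrow> f \<noteq> 0 \<Longrightarrow> P (inverse f)"
  shows "P f"
proof (induction f)
  case (Fract M N)
  have emb: "P (emb M)" for M
  proof (induction M rule: mpoly_induct)
    case (add f g)
    then show ?case by (metis assms(3) emb.add)
  next
    case (mult f g)
    then show ?case by (metis assms(4) emb.mult)
  qed (use const var in \<open>simp_all add: const_conv_emb X_conv_emb\<close>)
  have "Fract M N = emb M * inverse (emb N)" by (simp add: emb_def)
  then show ?case
    using Fract by (metis assms(4) assms(5) emb emb_eq_0_iff)
qed

lemma field_morphism_eqI:
  fixes f g :: "ratfun \<Rightarrow> 'b::field"
  assumes "field_morphism f" "field_morphism g"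
    and "\<And>c. f (const c) = g (const c)" "\<And>v. f (X v) = g (X v)"
  shows "f = g"
proof
  interpret f: field_morphism f by fact
  interpret g: field_morphism g by fact
  show "f x = g x" for x
    by (induction x rule: ratfun_induct)
      (simp_all add: assms f.field_hom_simps g.field_hom_simps)
qed

text \<open>The trivial kernel keeps the images of denominators nonzero, so \<open>e a / e b\<close>
  is meaningful, and cross-multiplication makes it independent of the chosen fraction.\<close>

lemma lift_to_ratfun:
  fixes e :: "mpoly \<Rightarrow> 'b::field"
  assumes "ring_morphism e" and inj: "\<And>N. e N = 0 \<Longrightarrow> N = 0"
  obtains w where "field_morphism w" "\<And>N. w (emb N) = e N"
proof -
  interpret e: ring_morphism e by fact
  define w where "w (f :: ratfun) = (THE y. \<forall>a b. b \<noteq> 0 \<longrightarrow> f = Fract a b \<longrightarrow> y = e a / e b)" for f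
  have nz: "e b \<noteq> 0" if "b \<noteq> 0" for b
    using inj that by blast
  have w: "w (Fract a b) = e a / e b" if "b \<noteq> 0" for a b
    unfolding w_def
  proof (rule the_equality, intro allI impI)
    fix c d assume "d \<noteq> 0" "Fract a b = Fract c d"
    then have "a * d = c * b" using that by (simp add: eq_fract)
    then have "e a * e d = e c * e b" by (metis e.mult)
    then show "e a / e b = e c / e d" using nz that \<open>d \<noteq> 0\<close> by (simp add: field_simps)
  qed (use that in blast)
  have "field_morphism w"
  proof (unfold_locales)
    fix x y :: ratfun
    obtain a b c d where "x = Fract a b" "b \<noteq> 0" "y = Fract c d" "d \<noteq> 0"
      by (metis Fract_cases)
    then show "w (x + y) = w x + w y" "w (x * y) = w x * w y"
      using nz by (simp_all add: w e.hom_simps field_simps)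
  next
    show "w 1 = 1" by (simp add: One_fract_def w e.one)
  qed
  then show thesis by (rule that) (simp add: emb_def w e.one)
qed

lemma emb_unique:
  assumes "ring_morphism e" "\<And>c. e (pconst c) = const c" "\<And>v. e (pvar v) = X v"
  shows "e N = emb N"
proof -
  interpret e: ring_morphism e by fact
  show ?thesis
    by (induction N rule: mpoly_induct)
      (simp_all add: assms e.hom_simps emb.hom_simps const_conv_emb X_conv_emb)
qed

text \<open>Evaluating the polynomials at \<open>x\<close> undoes the substitution, so the
  substitution is injective on polynomials and extends to fractions. The target is the field of
  Laurent series because a denominator may have constant term 0.\<close>

lemma taylor_morphism:
  fixes g :: "var \<Rightarrow> ratfun poly" and x :: ratfun
  assumes g: "\<And>v. poly (g v) x = X v"
  obtains T where "field_morphism T" "\<And>c. T (const c) = fls_const (const c)"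
    "\<And>v. T (X v) = fps_to_fls (fps_of_poly (g v))"
proof -
  have k: "ring_morphism (\<lambda>c. [:const c:])"
    by unfold_locales (simp_all add: const.hom_simps)
  define e where "e = meval (\<lambda>c. [:const c:]) g"
  have e: "ring_morphism e" "e (pconst c) = [:const c:]" "e (pvar v) = g v" for c v
    unfolding e_def by (rule ring_morphism_meval[OF k])+
  interpret e: ring_morphism e by fact
  have e_at_x: "poly (e N) x = emb N" for N
    by (rule emb_unique) (unfold_locales, simp_all add: e.hom_simps e g)
  let ?E = "\<lambda>N. fps_to_fls (fps_of_poly (e N))"
  have "ring_morphism ?E"
    by unfold_locales (simp_all add: e.hom_simps fps_of_poly_add fps_of_poly_mult fls_times_fps_to_fls)
  moreover have "N = 0" if "?E N = 0" for N
    using that e_at_x[of N] fps_of_poly_eq_iff[of "e N" 0] by (simp add: emb_eq_0_iff)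
  ultimately obtain T where "field_morphism T" "\<And>N. T (emb N) = ?E N"
    using lift_to_ratfun[of ?E] by blast
  then show thesis
    by (intro that[of T]) (simp_all add: const_conv_emb X_conv_emb e fps_of_poly_const)
qed

section \<open>Partial derivatives\<close>

locale ratfun_derivation =
  fixes d :: "ratfun \<Rightarrow> ratfun"
  assumes derivation: "derivation d"
begin

lemma const: "d (const c) = 0" and add: "d (f + g) = d f + d g"
  and mult: "d (f * g) = d f * g + f * d g"
  using derivation by (simp_all add: derivation_def)

lemma numeral: "d (numeral n) = 0" and zero: "d 0 = 0" and one: "d 1 = 0"
  using const[of "numeral n"] const[of 0] const[of 1] by (simp_all add: const.hom_simps)

lemma of_int: "d (of_int n) = 0"
  using const[of "of_int n"] by (simp add: const.of_int)

lemma uminus: "d (- f) = - d f"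
  using add[of f "- f"] by (simp add: zero eq_neg_iff_add_eq_0 add.commute)

lemma diff: "d (f - g) = d f - d g"
  using add[of f "- g"] by (simp add: uminus)

lemma inverse: "d (inverse f) = - d f / f ^ 2"
proof (cases "f = 0")
  case False
  then have "d f * inverse f + f * d (inverse f) = 0"
    using mult[of f "inverse f"] by (simp add: one)
  then have "f * d (inverse f) = - (d f * inverse f)"
    by (simp add: add_eq_0_iff)
  then have *: "inverse f * (f * d (inverse f)) = - (d f / f ^ 2)"
    by (simp add: divide_inverse power2_eq_square)
  have "inverse f * (f * d (inverse f)) = d (inverse f)"
    using False by (simp flip: mult.assoc)
  with * show ?thesis by simp
qed (simp add: zero)

lemma divide: "d (f / g) = (d f * g - f * d g) / g ^ 2"
proof (cases "g = 0")
  case False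
  have "d (f / g) = d f * inverse g + f * (- d g / g ^ 2)"
    unfolding divide_inverse[of f] mult inverse ..
  with False show ?thesis by (simp add: field_simps power2_eq_square)
qed (simp add: zero)

lemmas derivation_simps = const numeral zero one of_int add uminus diff mult divide

end

lemma derivation_eqI:
  assumes "derivation d" "derivation d'" "\<And>v. d (X v) = d' (X v)"
  shows "d = d'"
proof
  interpret d: ratfun_derivation d by unfold_locales fact
  interpret d': ratfun_derivation d' by unfold_locales fact
  show "d f = d' f" for f
    by (induction f rule: ratfun_induct)
      (simp_all add: assms d.derivation_simps d'.derivation_simps d.inverse d'.inverse)
qed

text \<open>The derivative of \<open>f\<close> is the coefficient of z after replacing the variable
  \<open>v\<close> by \<open>v + z\<close>.\<close>

lemma ex_partial: "\<exists>d. derivation d \<and> (\<forall>u. d (X u) = (if u = v then 1 else 0))"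
proof -
  let ?g = "\<lambda>u. [:X u, if u = v then 1 else 0:]"
  obtain T where "field_morphism T" and T_const: "\<And>c. T (const c) = fls_const (const c)"
    and T_X: "\<And>u. T (X u) = fps_to_fls (fps_of_poly (?g u))"
    by (rule taylor_morphism[of ?g 0]) simp_all
  interpret T: field_morphism T by fact
  \<comment> \<open>The constant term is \<open>f\<close> itself, hence nonzero whenever
    \<open>f\<close> is, so inverses remain power series. The same constant term supplies the
    undifferentiated factors in the product rule.\<close>
  have T_fps: "\<exists>F. T f = fps_to_fls F \<and> F $ 0 = f" for f
  proof (induction f rule: ratfun_induct)
    case (const c)
    then show ?case by (intro exI[of _ "fps_const (const c)"]) (simp add: T_const)
  next
    case (var u)
    then show ?case by (intro exI[of _ "fps_of_poly (?g u)"]) (simp add: T_X)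
  next
    case (add f g)
    then obtain F G where "T f = fps_to_fls F" "F $ 0 = f" "T g = fps_to_fls G" "G $ 0 = g"
      by blast
    then show ?case by (intro exI[of _ "F + G"]) (simp add: T.add)
  next
    case (mult f g)
    then obtain F G where "T f = fps_to_fls F" "F $ 0 = f" "T g = fps_to_fls G" "G $ 0 = g"
      by blast
    then show ?case by (intro exI[of _ "F * G"]) (simp add: T.mult fls_times_fps_to_fls)
  next
    case (inverse f)
    then obtain F where "T f = fps_to_fls F" "F $ 0 = f" by blast
    then show ?case using \<open>f \<noteq> 0\<close>
      by (intro exI[of _ "inverse F"]) (simp add: T.inverse fls_inverse_fps_to_fls)
  qed
  let ?d = "\<lambda>f. fls_nth (T f) 1"
  have d_fps: "T f = fps_to_fls F \<Longrightarrow> ?d f = F $ 1" for f F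
    by simp
  have "derivation ?d"
    unfolding derivation_def
  proof (intro conjI allI)
    fix f g
    obtain F G where F: "T f = fps_to_fls F" "F $ 0 = f" and G: "T g = fps_to_fls G" "G $ 0 = g"
      using T_fps by meson
    have "T (f * g) = fps_to_fls (F * G)"
      by (simp add: T.mult F G fls_times_fps_to_fls)
    then show "?d (f * g) = ?d f * g + f * ?d g"
      using d_fps[OF F(1)] d_fps[OF G(1)] F(2) G(2) by (simp add: d_fps fps_mult_nth)
  qed (simp_all add: T_const T.add)
  moreover have "?d (X u) = (if u = v then 1 else 0)" for u
    using d_fps[OF T_X[of u]] by simp
  ultimately show ?thesis by blast
qed

lemma
  shows derivation_partial: "derivation (partial v)"
    and partial_X: "partial v (X u) = (if u = v then 1 else 0)"
proof -
  have "\<exists>!d. derivation d \<and> (\<forall>u. d (X u) = (if u = v then 1 else 0))"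
    using ex_partial by (rule ex_ex1I) (metis derivation_eqI)
  then have "derivation (partial v) \<and> (\<forall>u. partial v (X u) = (if u = v then 1 else 0))"
    unfolding partial_def by (rule theI')
  then show "derivation (partial v)" "partial v (X u) = (if u = v then 1 else 0)"
    by blast+
qed

interpretation partial: ratfun_derivation "partial v" for v
  by unfold_locales (rule derivation_partial)

lemma chain_rule:
  assumes "field_morphism w" "\<And>c. w (const c) = const c"
  shows "partial v (w f) = (\<Sum>u\<in>UNIV. w (partial u f) * partial v (w (X u)))"
proof -
  interpret w: field_morphism w by fact
  show ?thesis
  proof (induction f rule: ratfun_induct)
    case (var u)
    have "(\<Sum>x\<in>UNIV. w (partial x (X u)) * partial v (w (X x))) =
        (\<Sum>x\<in>UNIV. if x = u then partial v (w (X u)) else 0)"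
      by (intro sum.cong) (auto simp: partial_X w.zero w.one)
    then show ?case by simp
  next
    case (inverse f)
    then show ?case
      by (simp add: w.field_hom_simps partial.inverse power2_eq_square divide_inverse
          sum_distrib_left sum_negf ac_simps)
  qed (simp_all add: assms w.field_hom_simps partial.derivation_simps ring_distribs sum.distrib
        sum_distrib_left sum_distrib_right ac_simps)
qed

section \<open>Automorphisms and canonical transformations\<close>

text \<open>The value at 1 is idempotent, and nonzero because \<open>w\<close> is injective and
  fixes 0; in a field this leaves only 1.\<close>

lemma automorphism_imp_field_morphism:
  assumes "automorphism w"
  shows "field_morphism w"
proof -
  have "w 1 * w 1 = w 1"
    using assms unfolding automorphism_def by (metis mult_1)
  moreover have "w 0 = 0"
    using assms unfolding automorphism_def by (metis add_cancel_right_left)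
  then have "w 1 \<noteq> 0"
    using assms unfolding automorphism_def by (metis bij_pointE zero_neq_one)
  ultimately have "w 1 = 1" by simp
  then show ?thesis
    using assms by unfold_locales (auto simp: automorphism_def)
qed

lemma automorphism_eqI:
  assumes "automorphism f" "automorphism g" "\<And>v. f (X v) = g (X v)"
  shows "f = g"
  using assms by (intro field_morphism_eqI automorphism_imp_field_morphism)
    (auto simp: automorphism_def)

lemma automorphism_involution:
  assumes "field_morphism w" "\<And>c. w (const c) = const c" "\<And>v. w (w (X v)) = X v"
  shows "automorphism w" "w \<circ> w = id"
proof -
  interpret w: field_morphism w by fact
  have "field_morphism (w \<circ> w)" "field_morphism (id :: ratfun \<Rightarrow> ratfun)"
    by (unfold_locales; simp add: w.hom_simps)+
  then show *: "w \<circ> w = id"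
  proof (rule field_morphism_eqI)
    show "(w \<circ> w) (const c) = id (const c)" "(w \<circ> w) (X v) = id (X v)" for c v
      by (simp_all add: assms(2,3))
  qed
  then have "bij w" using o_bij by blast
  then show "automorphism w"
    by (simp add: automorphism_def assms w.field_hom_simps)
qed

text \<open>Injectivity on polynomials: on the localisation at \<open>d\<close> the substitution is an involution.\<close>

lemma substitution_involution:
  fixes h :: "var \<Rightarrow> ratfun"
  defines "e \<equiv> meval const h"
  assumes d: "d \<noteq> 0" "e d = emb d"
    and h: "\<And>v. \<exists>M k. h v * emb d ^ k = emb M \<and> e M = X v * emb d ^ k"
  obtains w where "automorphism w" "w \<circ> w = id" "\<And>v. w (X v) = h v"
proof -
  note e_simps = ring_morphism_meval[OF const.ring_morphism_axioms, of h, folded e_def]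
  interpret e: ring_morphism e by (rule e_simps)
  have emb_d: "emb d \<noteq> 0" using d by (simp add: emb_eq_0_iff)
  \<comment> \<open>Since \<open>e\<close> maps polynomials to rational functions, it cannot be
    applied twice. The numerator \<open>M\<close> of \<open>e N\<close> over a power of
    \<open>d\<close> takes the place of \<open>e N\<close>; as \<open>e\<close> fixes
    \<open>d\<close>, such numerators survive sums and products.\<close>
  have inverse_image: "\<exists>M k. e N * emb d ^ k = emb M \<and> e M = emb N * emb d ^ k" for N
  proof (induction N rule: mpoly_induct)
    case (const c)
    show ?case by (rule exI[of _ "pconst c"], rule exI[of _ 0]) (simp add: e_simps const_conv_emb)
  next
    case (var v)
    then show ?case using h[of v] by (simp add: e_simps X_conv_emb)
  next
    case (add f g)
    then obtain M k M' k' where eqs: "e f * emb d ^ k = emb M" "e M = emb f * emb d ^ k"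
      "e g * emb d ^ k' = emb M'" "e M' = emb g * emb d ^ k'" by auto
    then show ?case
      by (intro exI[of _ "M * d ^ k' + M' * d ^ k"] exI[of _ "k + k'"])
        (simp add: e.hom_simps emb.hom_simps d eqs(2,4) power_add algebra_simps flip: eqs(1,3))
  next
    case (mult f g)
    then obtain M k M' k' where eqs: "e f * emb d ^ k = emb M" "e M = emb f * emb d ^ k"
      "e g * emb d ^ k' = emb M'" "e M' = emb g * emb d ^ k'" by auto
    then show ?case
      by (intro exI[of _ "M * M'"] exI[of _ "k + k'"])
        (simp add: e.hom_simps emb.hom_simps eqs(2,4) power_add ac_simps flip: eqs(1,3))
  qed
  have inj: "N = 0" if "e N = 0" for N
    using inverse_image[of N] that emb_d by (auto simp: emb_eq_0_iff e.zero)
  obtain w where "field_morphism w" and w_emb: "\<And>N. w (emb N) = e N"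
    using lift_to_ratfun[OF e.ring_morphism_axioms inj] by blast
  interpret w: field_morphism w by fact
  have w_const: "w (const c) = const c" and w_X: "w (X v) = h v" for c v
    by (simp_all add: const_conv_emb X_conv_emb w_emb e_simps)
  moreover have "w (w (X v)) = X v" for v
  proof -
    obtain M k where M: "h v * emb d ^ k = emb M" "e M = X v * emb d ^ k" using h by blast
    have "w (h v) * emb d ^ k = X v * emb d ^ k"
      using arg_cong[OF M(1), of w] by (simp add: w.hom_simps w_emb d M(2))
    with emb_d show ?thesis by (simp add: w_X)
  qed
  ultimately show thesis
    using automorphism_involution[OF \<open>field_morphism w\<close>] that by blast
qed

definition poisson :: "ratfun \<Rightarrow> ratfun \<Rightarrow> ratfun" where
  "poisson f g = partial Vq f * partial Vp g - partial Vp f * partial Vq g"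

text \<open>Only derivatives of \<open>I\<close> enter \<open>ddt\<close>, so \<open>I\<close> may
  be replaced by \<open>w I\<close>. The chain rule then turns the bracket of \<open>w f\<close> and
  \<open>w I\<close> into \<open>w\<close> of the bracket of \<open>f\<close> and \<open>I\<close>,
  times the bracket of \<open>w q\<close> and \<open>w p\<close>.\<close>

lemma ddt_canonical:
  assumes w: "automorphism w" and t: "w (X Vt) = X Vt"
    and params: "\<And>u v. u \<in> {Vq, Vp, Vt} \<Longrightarrow> v \<notin> {Vq, Vp, Vt} \<Longrightarrow> partial u (w (X v)) = 0"
    and qp: "partial Vt (w (X Vq)) = 0" "partial Vt (w (X Vp)) = 0"
    and jacobian: "poisson (w (X Vq)) (w (X Vp)) = 1"
    and ham: "partial Vq (w I) = partial Vq I" "partial Vp (w I) = partial Vp I"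
  shows "ddt (w f) = w (ddt f)"
proof -
  interpret w: field_morphism w by (rule automorphism_imp_field_morphism[OF w])
  have const: "w (const c) = const c" for c
    using w by (simp add: automorphism_def)
  note chain = chain_rule[OF w.field_morphism_axioms const]
  have wq: "partial u (w f) = w (partial Vq f) * partial u (w (X Vq)) +
      w (partial Vp f) * partial u (w (X Vp))" if "u = Vq \<or> u = Vp" for u f
    using that by (subst chain) (auto simp: UNIV_var params t partial_X)
  have wt: "partial Vt (w f) = w (partial Vt f)" for f
    by (subst chain) (simp add: UNIV_var params t qp partial_X)
  let ?Q = "w (X Vq)" and ?P = "w (X Vp)"
  have "ddt (w f) = poisson (w f) (w I) + w (partial Vt f)"
    by (simp add: ddt_def poisson_def ham wt)
  also have "poisson (w f) (w I) =
      (w (partial Vq f) * w (partial Vp I) - w (partial Vp f) * w (partial Vq I)) * poisson ?Q ?P"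
    by (simp add: poisson_def wq[of _ f] wq[of _ I] algebra_simps)
  finally show ?thesis
    by (simp add: jacobian ddt_def w.hom_simps)
qed

lemma partial_par: "u \<in> {Vq, Vp, Vt} \<Longrightarrow> j \<le> 8 \<Longrightarrow> partial u (par j) = 0"
proof -
  assume "u \<in> {Vq, Vp, Vt}" "j \<le> 8"
  then have "j = 0 \<or> j = 1 \<or> j = 2 \<or> j = 3 \<or> j = 4 \<or> j = 5 \<or> j = 6 \<or> j = 7 \<or> j = 8" by linarith
  with \<open>u \<in> _\<close> show ?thesis
    by (elim disjE insertE) (simp_all add: par_def partial_X partial.derivation_simps)
qed

text \<open>Apply \<open>w\<close> to the equations of motion; the new time has derivative
  \<open>w 1 = 1\<close>. Commuting with \<open>ddt\<close> is visibly stable under composition,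
  which is why it serves as the working notion.\<close>

lemma baecklund_if_commutes:
  assumes w: "automorphism w" and comm: "\<And>f. ddt (w f) = w (ddt f)"
  shows "baecklund w"
proof -
  interpret w: field_morphism w by (rule automorphism_imp_field_morphism[OF w])
  have "ddt (par j) = 0" if "j \<le> 8" for j
    using that by (simp add: ddt_def partial_par)
  moreover have "ddt (X Vt) = 1" "ddt (X Vq) = partial Vp I" "ddt (X Vp) = - partial Vq I"
    by (simp_all add: ddt_def partial_X)
  ultimately show ?thesis
    using w by (simp add: baecklund_def comm w.zero w.one)
qed

section \<open>Elementary symmetric functions by recursion on the index set\<close>

lemma sum_Pow_insert:
  assumes "finite A" "x \<notin> A"
  shows "sum f (Pow (insert x A)) = (\<Sum>S\<in>Pow A. f S + f (insert x S))"
proof -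
  have "inj_on (insert x) (Pow A)"
  proof (rule inj_onI)
    fix S T assume "S \<in> Pow A" "T \<in> Pow A" and eq: "insert x S = insert x T"
    then have "S = insert x S - {x}" "T = insert x T - {x}"
      using assms(2) by (simp_all only: Pow_iff) blast+
    with eq show "S = T" by argo
  qed
  then have "sum f (insert x ` Pow A) = (\<Sum>S\<in>Pow A. f (insert x S))"
    by (simp add: sum.reindex)
  moreover have "Pow A \<inter> insert x ` Pow A = {}"
    using assms(2) by blast
  ultimately show ?thesis
    using assms(1) by (simp add: Pow_insert sum.union_disjoint sum.distrib)
qed

context fixes \<alpha> :: "nat \<Rightarrow> 'a::comm_ring_1"
begin

text \<open>The index set is arbitrary so that its elements can be inserted one at a time; the
  condition sits inside the sum so that the sum over a power set splits.\<close>

definition esym :: "nat set \<Rightarrow> nat \<Rightarrow> 'a" where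
  "esym A n = (\<Sum>S\<in>Pow A. if card S = n then \<Prod>k\<in>S. \<rho> \<alpha> k else 0)"

lemma esym_empty: "esym {} n = (if n = 0 then 1 else 0)"
  by (simp add: esym_def)

lemma esym_insert_0:
  assumes "finite A" "x \<notin> A"
  shows "esym (insert x A) 0 = esym A 0"
  unfolding esym_def sum_Pow_insert[OF assms]
proof (rule sum.cong[OF HOL.refl])
  fix S assume "S \<in> Pow A"
  then have "finite S" using assms(1) finite_subset by blast
  then show "(if card S = 0 then \<Prod>k\<in>S. \<rho> \<alpha> k else 0)
      + (if card (insert x S) = 0 then \<Prod>k\<in>insert x S. \<rho> \<alpha> k else 0)
      = (if card S = 0 then \<Prod>k\<in>S. \<rho> \<alpha> k else 0)"
    by (cases "S = {}") (simp_all add: card_insert_if)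
qed

lemma esym_insert_Suc:
  assumes "finite A" "x \<notin> A"
  shows "esym (insert x A) (Suc n) = esym A (Suc n) + \<rho> \<alpha> x * esym A n"
  unfolding esym_def sum_Pow_insert[OF assms] sum_distrib_left sum.distrib[symmetric]
proof (rule sum.cong[OF HOL.refl])
  fix S assume "S \<in> Pow A"
  then have "finite S" "x \<notin> S" using assms finite_subset by blast+
  then show "(if card S = Suc n then \<Prod>k\<in>S. \<rho> \<alpha> k else 0)
      + (if card (insert x S) = Suc n then \<Prod>k\<in>insert x S. \<rho> \<alpha> k else 0)
      = (if card S = Suc n then \<Prod>k\<in>S. \<rho> \<alpha> k else 0)
      + \<rho> \<alpha> x * (if card S = n then \<Prod>k\<in>S. \<rho> \<alpha> k else 0)"
    by simp
qed

lemma beta_conv_esym: "\<beta> \<alpha> n = esym {5, 4, 3, 2, 1} n"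
proof -
  have *: "{1..5::nat} = {5, 4, 3, 2, 1}"
    by (simp add: eval_nat_numeral atLeastAtMostSuc_conv)
  have "{S. S \<subseteq> {1..5::nat} \<and> card S = n} = {S \<in> Pow {1..5}. card S = n}"
    by simp
  then show ?thesis
    unfolding \<beta>_def esym_def *[symmetric] by (simp only: sum.inter_filter finite_Pow_iff finite_atLeastAtMost)
qed

lemma esym_insert_numeral:
  assumes "finite A" "x \<notin> A"
  shows "esym (insert x A) 1 = esym A 1 + \<rho> \<alpha> x * esym A 0"
    and "esym (insert x A) (numeral n) = esym A (numeral n) + \<rho> \<alpha> x * esym A (pred_numeral n)"
  using esym_insert_Suc[OF assms] by (simp_all add: numeral_eq_Suc)

lemmas esym_simps = esym_empty esym_insert_0 esym_insert_numeral esym_insert_numeral(1)[simplified]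

end

section \<open>The symmetry of the Hamiltonian\<close>

text \<open>Up to the factor \<open>q\<close>, the Hamiltonian is a polynomial of degree 4 in \<open>q\<close> whose coefficients \<open>F0, \<dots>, F4\<close>
  are polynomials in \<open>u = q p\<close>. The transformations \<open>s\<^sub>0\<close> and \<open>s\<^sub>1\<close> shift \<open>u\<close> by a constant, and \<open>s\<^sub>1\<close> fixes
  \<open>q\<close>, \<open>s\<^sub>0\<close> fixes \<open>p\<close>; so the symmetry can be checked for each coefficient separately. Only \<open>F1\<close>, the coefficient of
  \<open>q\<^sup>0\<close> in the Hamiltonian, changes, by a constant. For \<open>s\<^sub>6\<close> the expansion in \<open>q - 1\<close> with \<open>u = (q - 1) p\<close>
  plays this role; its coefficients are \<open>K0, \<dots>, K4\<close> and again \<open>F4\<close>.\<close>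

context
  fixes \<alpha> :: "nat \<Rightarrow> 'a::comm_ring_1"
begin

text \<open>\<open>- D3\<close> and \<open>D2\<close> are the coefficients of q in the brackets of
  \<open>ham\<close> at p^3 and p^2. They make these brackets equal to
  \<open>- 2*\<gamma>1*\<gamma>2\<close> and \<open>\<gamma>2^2\<close> at q = 1.\<close>

definition "D3 = A3 \<alpha> + xI \<alpha> + \<beta> \<alpha> 3 + 2*\<gamma>1 \<alpha>*\<gamma>2 \<alpha>"
definition "D2 = \<gamma>2 \<alpha>^2 - A2 \<alpha> - B2 \<alpha> - C2 \<alpha> - \<beta> \<alpha> 4"

text \<open>This is u times the product of the factors \<open>u - \<rho> k\<close> for k = 1, ...,
  5.\<close>

definition "F0 u = u^6 - \<beta> \<alpha> 1*u^5 + \<beta> \<alpha> 2*u^4 - \<beta> \<alpha> 3*u^3 + \<beta> \<alpha> 4*u^2 - \<beta> \<alpha> 5*u"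

definition "F1 u = - 4*u^6 + 3*(\<beta> \<alpha> 1 - \<kappa> \<alpha>)*u^5 + (mI \<alpha> - 2*\<beta> \<alpha> 2)*u^4 + (D3 + \<beta> \<alpha> 3)*u^3
  + D2*u^2 + G1 \<alpha>*u"

text \<open>By the linear relation, \<open>F2\<close> is divisible by
  \<open>u^2 + \<kappa>*u + \<epsilon>\<close>, the lowest coefficients of the quotient being
  \<open>c2\<close>, \<open>c1\<close>, \<open>c0\<close>; likewise \<open>F3\<close> is divisible
  by the square, with constant term \<open>b0\<close> of the quotient.\<close>

definition "F2 u = 6*u^6 + (9*\<kappa> \<alpha> - 3*\<beta> \<alpha> 1)*u^5 + (3*(\<kappa> \<alpha>^2 + \<epsilon> \<alpha>) - 2*mI \<alpha> + \<beta> \<alpha> 2)*u^4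
  - (xI \<alpha> + D3)*u^3 + C2 \<alpha>*u^2 + C1 \<alpha>*u + \<epsilon> \<alpha>*c0 \<alpha>"

definition "F3 u = - 4*u^6 + (\<beta> \<alpha> 1 - 9*\<kappa> \<alpha>)*u^5 + (mI \<alpha> - 6*(\<kappa> \<alpha>^2 + \<epsilon> \<alpha>))*u^4
  + (xI \<alpha> - A3 \<alpha>)*u^3 + B2 \<alpha>*u^2 + B1 \<alpha>*u + \<epsilon> \<alpha>^2*b0 \<alpha>"

text \<open>The cube of \<open>u^2 + \<kappa>*u + \<epsilon>\<close>, which is the product of
  \<open>u + \<alpha> 0\<close> and \<open>u + \<alpha> 0 + \<alpha> 8\<close>.\<close>

definition "F4 u = u^6 + 3*\<kappa> \<alpha>*u^5 + 3*(\<kappa> \<alpha>^2 + \<epsilon> \<alpha>)*u^4 + A3 \<alpha>*u^3 + A2 \<alpha>*u^2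
  + 3*\<kappa> \<alpha>*\<epsilon> \<alpha>^2*u + \<epsilon> \<alpha>^3"

text \<open>By the linear relation, the square of the product of u, \<open>u - \<alpha> 6\<close>
  and \<open>u - \<alpha> 6 - \<alpha> 7\<close>.\<close>

definition "K0 u = u^6 + (3*\<kappa> \<alpha> + \<beta> \<alpha> 1)*u^5 + (3*(\<kappa> \<alpha>^2 + \<epsilon> \<alpha>) + mI \<alpha> + \<beta> \<alpha> 2)*u^4
  + (A3 \<alpha> + xI \<alpha> - D3 + \<beta> \<alpha> 3)*u^3 + (A2 \<alpha> + B2 \<alpha> + C2 \<alpha> + D2 + \<beta> \<alpha> 4)*u^2"

text \<open>By the linear relation, divisible by the product of u, \<open>u - \<alpha> 6\<close> and
  \<open>u - \<alpha> 6 - \<alpha> 7\<close>; the constant term of the quotient is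
  \<open>k0\<close>.\<close>

definition "K1 u = 5*u^6 + (15*\<kappa> \<alpha> + 4*\<beta> \<alpha> 1)*u^5
  + (15*(\<kappa> \<alpha>^2 + \<epsilon> \<alpha>) + 4*mI \<alpha> + 3*\<beta> \<alpha> 2)*u^4
  + (5*A3 \<alpha> + 4*xI \<alpha> - 3*D3 + 2*\<beta> \<alpha> 3)*u^3
  + (5*A2 \<alpha> + 4*B2 \<alpha> + 3*C2 \<alpha> + 2*D2 + \<beta> \<alpha> 4)*u^2
  + (3*\<kappa> \<alpha>*\<epsilon> \<alpha>^2 + B1 \<alpha> + C1 \<alpha> + G1 \<alpha> - \<beta> \<alpha> 5)*u"

definition "K2 u = 10*u^6 + (30*\<kappa> \<alpha> + 6*\<beta> \<alpha> 1)*u^5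
  + (30*(\<kappa> \<alpha>^2 + \<epsilon> \<alpha>) + 6*mI \<alpha> + 3*\<beta> \<alpha> 2)*u^4
  + (10*A3 \<alpha> + 6*xI \<alpha> - 3*D3 + \<beta> \<alpha> 3)*u^3
  + (10*A2 \<alpha> + 6*B2 \<alpha> + 3*C2 \<alpha> + D2)*u^2
  + (12*\<kappa> \<alpha>*\<epsilon> \<alpha>^2 + 3*B1 \<alpha> + 2*C1 \<alpha> + G1 \<alpha>)*u
  + \<epsilon> \<alpha>^3 + \<epsilon> \<alpha>^2*b0 \<alpha> + \<epsilon> \<alpha>*c0 \<alpha>"

definition "K3 u = 10*u^6 + (30*\<kappa> \<alpha> + 4*\<beta> \<alpha> 1)*u^5
  + (30*(\<kappa> \<alpha>^2 + \<epsilon> \<alpha>) + 4*mI \<alpha> + \<beta> \<alpha> 2)*u^4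
  + (10*A3 \<alpha> + 4*xI \<alpha> - D3)*u^3 + (10*A2 \<alpha> + 4*B2 \<alpha> + C2 \<alpha>)*u^2
  + (18*\<kappa> \<alpha>*\<epsilon> \<alpha>^2 + 3*B1 \<alpha> + C1 \<alpha>)*u
  + 3*\<epsilon> \<alpha>^3 + 2*\<epsilon> \<alpha>^2*b0 \<alpha> + \<epsilon> \<alpha>*c0 \<alpha>"

definition "K4 u = 5*u^6 + (15*\<kappa> \<alpha> + \<beta> \<alpha> 1)*u^5 + (15*(\<kappa> \<alpha>^2 + \<epsilon> \<alpha>) + mI \<alpha>)*u^4
  + (5*A3 \<alpha> + xI \<alpha>)*u^3 + (5*A2 \<alpha> + B2 \<alpha>)*u^2 + (12*\<kappa> \<alpha>*\<epsilon> \<alpha>^2 + B1 \<alpha>)*u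
  + 3*\<epsilon> \<alpha>^3 + \<epsilon> \<alpha>^2*b0 \<alpha>"

end

lemmas expansion_defs = F0_def F1_def F2_def F3_def F4_def K0_def K1_def K2_def K3_def K4_def
  D3_def D2_def

lemmas coeff_defs = expansion_defs G1_def C1_def B1_def c0_def c1_def c2_def C2_def B2_def A2_def
  k0_def xI_def A3_def b0_def mI_def vI_def

text \<open>Here \<open>a = \<rho> 1\<close> and \<open>e2, e3, e4\<close> are the elementary symmetric functions of \<open>\<rho> 2, \<dots>, \<rho> 5\<close>, with
  \<open>e1\<close> eliminated by the linear relation; \<open>s\<^sub>1\<close> maps \<open>\<rho> 1\<close> to \<open>- a\<close> and \<open>\<rho> k\<close> to \<open>\<rho> k - a\<close> for \<open>k \<ge> 2\<close>.\<close>

lemma F_shift_1: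
  fixes \<alpha> \<alpha>' :: "nat \<Rightarrow> 'a::idom"
  assumes "\<kappa> \<alpha>' = \<kappa> \<alpha> + 2*a"
    and "\<epsilon> \<alpha>' = \<epsilon> \<alpha> + \<kappa> \<alpha>*a + a^2"
    and "\<gamma>1 \<alpha>' = \<gamma>1 \<alpha>"
    and "\<gamma>2 \<alpha>' = \<gamma>2 \<alpha>"
    and "\<beta> \<alpha> 1 = (- 3*\<kappa> \<alpha> - 2*\<gamma>1 \<alpha> - a) + a"
    and "\<beta> \<alpha> 2 = e2 + a*(- 3*\<kappa> \<alpha> - 2*\<gamma>1 \<alpha> - a)"
    and "\<beta> \<alpha> 3 = e3 + a*e2"
    and "\<beta> \<alpha> 4 = e4 + a*e3"
    and "\<beta> \<alpha> 5 = a*e4"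
    and "\<beta> \<alpha>' 1 = ((- 3*\<kappa> \<alpha> - 2*\<gamma>1 \<alpha> - a) - 4*a) - a"
    and "\<beta> \<alpha>' 2 = (e2 - 3*a*(- 3*\<kappa> \<alpha> - 2*\<gamma>1 \<alpha> - a) + 6*a^2)
      - a*((- 3*\<kappa> \<alpha> - 2*\<gamma>1 \<alpha> - a) - 4*a)"
    and "\<beta> \<alpha>' 3 = (e3 - 2*a*e2 + 3*a^2*(- 3*\<kappa> \<alpha> - 2*\<gamma>1 \<alpha> - a) - 4*a^3)
      - a*(e2 - 3*a*(- 3*\<kappa> \<alpha> - 2*\<gamma>1 \<alpha> - a) + 6*a^2)"
    and "\<beta> \<alpha>' 4 = (e4 - a*e3 + a^2*e2 - a^3*(- 3*\<kappa> \<alpha> - 2*\<gamma>1 \<alpha> - a) + a^4)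
      - a*(e3 - 2*a*e2 + 3*a^2*(- 3*\<kappa> \<alpha> - 2*\<gamma>1 \<alpha> - a) - 4*a^3)"
    and "\<beta> \<alpha>' 5 = - a*(e4 - a*e3 + a^2*e2 - a^3*(- 3*\<kappa> \<alpha> - 2*\<gamma>1 \<alpha> - a) + a^4)"
  shows "F0 \<alpha>' (u - a) = F0 \<alpha> u"
    and "F2 \<alpha>' (u - a) = F2 \<alpha> u"
    and "F3 \<alpha>' (u - a) = F3 \<alpha> u"
    and "F4 \<alpha>' (u - a) = F4 \<alpha> u"
    and "F1 \<alpha>' (u - a) = F1 \<alpha> u + F1 \<alpha>' (- a)"
  unfolding coeff_defs assms power_zero_numeral mult_zero_right add_0_left
  by algebra+

text \<open>Here \<open>a\<close> is \<open>\<alpha> 6\<close>, and the two equations for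
  \<open>\<gamma>2\<close> say that \<open>\<alpha> 6\<close> is a factor of it. The coefficient of
  (q - 1)^0 in the Hamiltonian is \<open>K2\<close>, the only one that changes; as \<open>K2\<close>
  need not vanish at 0, the constant is a difference of two values.\<close>

lemma K_shift_6:
  fixes \<alpha> \<alpha>' :: "nat \<Rightarrow> 'a::idom"
  assumes "\<kappa> \<alpha>' = \<kappa> \<alpha> + 2*a"
    and "\<epsilon> \<alpha>' = \<epsilon> \<alpha> + \<kappa> \<alpha>*a + a^2"
    and "\<gamma>1 \<alpha>' = \<gamma>1 \<alpha> - 3*a"
    and "\<gamma>2 \<alpha> = a*(\<gamma>1 \<alpha> - a)"
    and "\<gamma>2 \<alpha>' = - a*(\<gamma>1 \<alpha> - 2*a)"
    and "\<beta> \<alpha>' 1 = \<beta> \<alpha> 1"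
    and "\<beta> \<alpha>' 2 = \<beta> \<alpha> 2"
    and "\<beta> \<alpha>' 3 = \<beta> \<alpha> 3"
    and "\<beta> \<alpha>' 4 = \<beta> \<alpha> 4"
    and "\<beta> \<alpha>' 5 = \<beta> \<alpha> 5"
    and "\<beta> \<alpha> 1 = - 3*\<kappa> \<alpha> - 2*\<gamma>1 \<alpha>"
  shows "K0 \<alpha>' (u - a) = K0 \<alpha> u"
    and "K1 \<alpha>' (u - a) = K1 \<alpha> u"
    and "K3 \<alpha>' (u - a) = K3 \<alpha> u"
    and "K4 \<alpha>' (u - a) = K4 \<alpha> u"
    and "F4 \<alpha>' (u - a) = F4 \<alpha> u"
    and "K2 \<alpha>' (u - a) + K2 \<alpha> 0 = K2 \<alpha> u + K2 \<alpha>' (- a)"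
  unfolding coeff_defs assms power_zero_numeral mult_zero_right add_0_left
  by algebra+

text \<open>Here \<open>a\<close> is \<open>\<alpha> 0\<close>. With p fixed, q^(k-1) is (u /
  p)^(k-1), so what has to be preserved is u^(k-1) times the k-th coefficient, except for the
  constant picked up at k = 1.\<close>

lemma F_shift_0:
  fixes \<alpha> \<alpha>' :: "nat \<Rightarrow> 'a::idom"
  assumes "\<epsilon> \<alpha> = a*(\<kappa> \<alpha> - a)"
    and "\<kappa> \<alpha>' = \<kappa> \<alpha> - 3*a"
    and "\<epsilon> \<alpha>' = - a*(\<kappa> \<alpha> - 2*a)"
    and "\<gamma>1 \<alpha>' = \<gamma>1 \<alpha> + 2*a"
    and "\<gamma>2 \<alpha>' = \<gamma>2 \<alpha> + a*\<gamma>1 \<alpha> + a^2"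
    and "\<beta> \<alpha>' 5 =
      \<beta> \<alpha> 5 + a*\<beta> \<alpha> 4 + a^2*\<beta> \<alpha> 3
      + a^3*\<beta> \<alpha> 2 + a^4*\<beta> \<alpha> 1 + a^5"
    and "\<beta> \<alpha>' 4 =
      \<beta> \<alpha> 4 + 2*a*\<beta> \<alpha> 3 + 3*a^2*\<beta> \<alpha> 2
      + 4*a^3*\<beta> \<alpha> 1 + 5*a^4"
    and "\<beta> \<alpha>' 3 =
      \<beta> \<alpha> 3 + 3*a*\<beta> \<alpha> 2 + 6*a^2*\<beta> \<alpha> 1 + 10*a^3"
    and "\<beta> \<alpha>' 2 = \<beta> \<alpha> 2 + 4*a*\<beta> \<alpha> 1 + 10*a^2"
    and "\<beta> \<alpha>' 1 = \<beta> \<alpha> 1 + 5*a"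
    and "\<beta> \<alpha> 1 = - 3*\<kappa> \<alpha> - 2*\<gamma>1 \<alpha>"
  shows "u * F0 \<alpha>' (u + a) = (u + a) * F0 \<alpha> u"
    and "F1 \<alpha>' (u + a) - F1 \<alpha> u = F1 \<alpha>' a"
    and "(u + a) * F2 \<alpha>' (u + a) = u * F2 \<alpha> u"
    and "(u + a)^2 * F3 \<alpha>' (u + a) = u^2 * F3 \<alpha> u"
    and "(u + a)^3 * F4 \<alpha>' (u + a) = u^3 * F4 \<alpha> u"
  unfolding coeff_defs assms power_zero_numeral mult_zero_right add_0_left
  by algebra+

section \<open>Presented groups\<close>

context
  fixes S :: "'g set" and R :: "('g \<times> bool) list set"
  assumes R: "R \<subseteq> words S"
begin

lemma word_rel_subset: "(u, v) \<in> word_rel S R \<Longrightarrow> u \<in> words S \<and> v \<in> words S"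
  by (induction rule: word_rel.induct) (use R in \<open>auto simp: words_def\<close>)

lemma equiv_word_rel: "equiv (words S) (word_rel S R)"
  by (rule equivI)
    (auto simp: refl_on_def sym_def trans_def dest: word_rel_subset
      intro: word_rel.refl word_rel.sym word_rel.trans)

lemma presented_group_mult:
  assumes "u \<in> words S" "v \<in> words S"
  shows "word_rel S R `` {u} \<otimes>\<^bsub>presented_group S R\<^esub> word_rel S R `` {v} = word_rel S R `` {u @ v}"
proof -
  have "word_rel S R `` {u' @ v' |u' v'. u' \<in> word_rel S R `` {u} \<and> v' \<in> word_rel S R `` {v}}
      = word_rel S R `` {u @ v}" (is "?L = ?R")
  proof
    show "?L \<subseteq> ?R"
      by (auto intro: word_rel.append word_rel.trans)
    show "?R \<subseteq> ?L"
      using assms by (auto intro!: word_rel.refl)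
  qed
  then show ?thesis by (simp add: presented_group_def)
qed

lemma carrier_presented_group:
  "carrier (presented_group S R) = (\<lambda>u. word_rel S R `` {u}) ` words S"
  by (auto simp: presented_group_def quotient_def)

lemma iso_presented_group:
  assumes G: "group G"
    and g: "g ` S \<subseteq> carrier G"
    and val_Nil: "val [] = \<one>\<^bsub>G\<^esub>"
    and val_letter: "\<And>x. x \<in> S \<Longrightarrow> val [(x, True)] = g x"
    and val_append: "\<And>u v. u \<in> words S \<Longrightarrow> v \<in> words S \<Longrightarrow> val (u @ v) = val u \<otimes>\<^bsub>G\<^esub> val v"
    and val_carrier: "\<And>u. u \<in> words S \<Longrightarrow> val u \<in> carrier (subgroup_generated G (g ` S))"
    and val_rel: "\<And>u v. u \<in> words S \<Longrightarrow> v \<in> words S \<Longrightarrow> (u, v) \<in> word_rel S R \<longleftrightarrow> val u = val v"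
  shows "\<exists>\<phi>\<in>iso (presented_group S R) (subgroup_generated G (g ` S)).
    \<forall>x\<in>S. \<phi> (word_rel S R `` {[(x, True)]}) = g x"
proof -
  interpret G: group G by fact
  let ?C = "\<lambda>u. word_rel S R `` {u}" and ?H = "subgroup_generated G (g ` S)"
  define \<phi> where "\<phi> U = val (SOME u. u \<in> U)" for U
  have class_eq: "?C u = ?C v \<longleftrightarrow> (u, v) \<in> word_rel S R" if "u \<in> words S" "v \<in> words S" for u v
    using eq_equiv_class_iff[OF equiv_word_rel that] .
  have \<phi>: "\<phi> (?C u) = val u" if u: "u \<in> words S" for u
  proof -
    have "(u, SOME v. v \<in> ?C u) \<in> word_rel S R"
      using someI[of "\<lambda>v. v \<in> ?C u" u] word_rel.refl[OF u] by auto
    then show ?thesis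
      using val_rel u word_rel_subset unfolding \<phi>_def by metis
  qed
  have append: "u @ v \<in> words S" if "u \<in> words S" "v \<in> words S" for u v
    using that by (simp add: words_def)
  have "\<phi> \<in> hom (presented_group S R) ?H"
    by (auto simp: hom_def carrier_presented_group \<phi> val_carrier presented_group_mult append val_append)
  moreover have "inj_on \<phi> (carrier (presented_group S R))"
    by (auto simp: inj_on_def carrier_presented_group \<phi> class_eq val_rel)
  moreover have "carrier ?H \<subseteq> val ` words S"
  proof -
    \<comment> \<open>How \<open>val\<close> treats an inverse letter is not prescribed; the
      cancellation rule forces the group inverse.\<close>
    have letter: "val [(x, False)] = inv\<^bsub>G\<^esub> g x" if "x \<in> S" for x
    proof -
      have w: "[(x, True)] \<in> words S" "[(x, False)] \<in> words S" using that by (simp_all add: words_def)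
      have "val [(x, True)] \<otimes>\<^bsub>G\<^esub> val [(x, False)] = val ([(x, True)] @ [(x, False)])"
        by (rule val_append[OF w, symmetric])
      also have "\<dots> = val []"
        using val_rel[of "[(x, True), (x, False)]" "[]"] word_rel.cancel[OF that, of True R] word_rel_subset
        by auto
      finally have "g x \<otimes>\<^bsub>G\<^esub> val [(x, False)] = \<one>\<^bsub>G\<^esub>"
        using val_letter that val_Nil by simp
      moreover have "val [(x, False)] \<in> carrier G"
        using val_carrier[OF w(2)] G.carrier_subgroup_generated_subset by blast
      ultimately show ?thesis
        using g that by (metis G.inv_equality G.inv_inv G.inv_comm image_subset_iff)
    qed
    have "x \<in> val ` words S" if "x \<in> generate G (carrier G \<inter> g ` S)" for x
      using that
    proof (induction rule: generate.induct)
      case one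
      have "[] \<in> words S" by (simp add: words_def)
      then show ?case using val_Nil by force
    next
      case (incl h)
      then obtain x where "x \<in> S" "h = g x" by blast
      moreover from this have "[(x, True)] \<in> words S" by (simp add: words_def)
      ultimately show ?case using val_letter by force
    next
      case (inv h)
      then obtain x where "x \<in> S" "h = g x" by blast
      moreover from this have "[(x, False)] \<in> words S" by (simp add: words_def)
      ultimately show ?case using letter by force
    next
      case (eng h1 h2)
      then show ?case using val_append append by (smt (verit) image_iff)
    qed
    then show ?thesis by (auto simp: carrier_subgroup_generated)
  qed
  then have "\<phi> ` carrier (presented_group S R) = carrier ?H"
    using val_carrier by (auto simp: carrier_presented_group \<phi> image_image)
  moreover have "\<phi> (?C [(x, True)]) = g x" if "x \<in> S" for x
    using that by (subst \<phi>) (auto simp: words_def val_letter)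
  ultimately show ?thesis
    by (intro bexI[of _ \<phi>]) (auto simp: iso_def bij_betw_def)
qed

end

section \<open>The reflection representation\<close>

text \<open>The negative of the Cartan matrix: the i-th reflection adds \<open>cox i j\<close> times
  \<open>\<alpha> i\<close> to \<open>\<alpha> j\<close>.\<close>

definition cox :: "nat \<Rightarrow> nat \<Rightarrow> int" where
  "cox i j = (if i = j then - 2 else if {i, j} \<in> E8_edges then 1 else 0)"

definition pair :: "nat \<Rightarrow> (nat \<Rightarrow> int) \<Rightarrow> int" where
  "pair i v = (\<Sum>j\<le>8. cox i j * v j)"

definition simple_root :: "nat \<Rightarrow> nat \<Rightarrow> int" where
  "simple_root i j = (if j = i then 1 else 0)"

definition reflection :: "nat \<Rightarrow> (nat \<Rightarrow> int) \<Rightarrow> nat \<Rightarrow> int" where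
  "reflection i v = (\<lambda>j. v j + pair i v * simple_root i j)"

lemma cox_sym: "cox i j = cox j i"
  by (simp add: cox_def insert_commute)

lemma pair_add_root:
  assumes "j \<le> 8"
  shows "pair i (\<lambda>k. v k + c * simple_root j k) = pair i v + c * cox i j"
proof -
  have "(\<Sum>k\<le>8. cox i k * (c * simple_root j k)) = (\<Sum>k\<le>8. if k = j then c * cox i j else 0)"
    by (intro sum.cong) (auto simp: simple_root_def)
  then show ?thesis
    using assms by (simp add: pair_def ring_distribs sum.distrib)
qed

lemma pair_root: "j \<le> 8 \<Longrightarrow> pair i (simple_root j) = cox i j"
  using pair_add_root[of j i "\<lambda>_. 0" 1] by (simp add: pair_def)

lemma pair_reflection: "j \<le> 8 \<Longrightarrow> pair i (reflection j v) = pair i v + pair j v * cox i j"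
  unfolding reflection_def by (rule pair_add_root)

lemma reflection_add: "reflection i (\<lambda>k. u k + v k) = (\<lambda>k. reflection i u k + reflection i v k)"
  by (simp add: reflection_def pair_def ring_distribs sum.distrib fun_eq_iff)

lemma reflection_uminus: "reflection i (\<lambda>k. - v k) = (\<lambda>k. - reflection i v k)"
  by (simp add: reflection_def pair_def sum_negf fun_eq_iff)

lemma reflection_apply: "reflection i v j = v j + pair i v * simple_root i j"
  by (simp add: reflection_def)

lemma reflection_comp_reflection: "i \<le> 8 \<Longrightarrow> reflection i \<circ> reflection i = id"
  by (intro ext) (simp add: reflection_apply pair_reflection cox_def)

lemma reflection_commute:
  assumes "i \<le> 8" "j \<le> 8" "cox i j = 0"
  shows "reflection i \<circ> reflection j = reflection j \<circ> reflection i"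
  using assms by (intro ext) (simp add: reflection_apply pair_reflection cox_sym[of j i])

lemma reflection_braid:
  assumes "i \<le> 8" "j \<le> 8" "cox i j = 1"
  shows "reflection i \<circ> reflection j \<circ> reflection i = reflection j \<circ> reflection i \<circ> reflection j"
proof -
  have "cox i i = - 2" "cox j j = - 2"
    by (simp_all add: cox_def)
  then show ?thesis
    using assms by (intro ext)
      (simp add: reflection_apply pair_reflection cox_sym[of j i] algebra_simps)
qed

lemma E8_edges_distinct: "{i, j} \<in> E8_edges \<Longrightarrow> i \<noteq> j"
  by (auto simp: E8_edges_def doubleton_eq_iff)

lemma cox_edge: "{i, j} \<in> E8_edges \<Longrightarrow> cox i j = 1"
  using E8_edges_distinct by (auto simp: cox_def)

lemma cox_nonedge: "i \<noteq> j \<Longrightarrow> {i, j} \<notin> E8_edges \<Longrightarrow> cox i j = 0"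
  by (simp add: cox_def)

lemma braid_imp_order_3:
  assumes "f \<circ> f = id" "g \<circ> g = id" "f \<circ> g \<circ> f = g \<circ> f \<circ> g"
  shows "(f \<circ> g) ^^ 3 = id"
proof -
  have "(f \<circ> g) ^^ 3 = (f \<circ> g \<circ> f) \<circ> (g \<circ> f \<circ> g)"
    by (simp add: numeral_3_eq_3 comp_assoc)
  also have "\<dots> = (g \<circ> f) \<circ> (g \<circ> g) \<circ> (f \<circ> g)"
    unfolding assms(3) by (simp only: comp_assoc)
  also have "\<dots> = g \<circ> (f \<circ> f) \<circ> g"
    by (simp only: assms(2) comp_id) (simp only: comp_assoc)
  finally show ?thesis by (simp add: assms)
qed

lemma commute_imp_order_2:
  assumes "f \<circ> f = id" "g \<circ> g = id" "f \<circ> g = g \<circ> f"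
  shows "(f \<circ> g) ^^ 2 = id"
proof -
  have "(f \<circ> g) ^^ 2 = f \<circ> (g \<circ> f) \<circ> g"
    by (simp add: numeral_2_eq_2 comp_assoc)
  also have "\<dots> = (f \<circ> f) \<circ> (g \<circ> g)"
    by (simp only: assms(3)[symmetric] comp_assoc)
  finally show ?thesis by (simp add: assms)
qed

text \<open>The exponent of a letter is ignored because the generators will act by
  involutions.\<close>

definition word_action :: "(nat \<Rightarrow> 'x \<Rightarrow> 'x) \<Rightarrow> (nat \<times> bool) list \<Rightarrow> 'x \<Rightarrow> 'x" where
  "word_action f u = foldr (\<lambda>x. (\<circ>) (f (fst x))) u id"

lemma word_action_simps [simp]:
  "word_action f [] = id" "word_action f (x # u) = f (fst x) \<circ> word_action f u"
  by (simp_all add: word_action_def)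

lemma word_action_append: "word_action f (u @ v) = word_action f u \<circ> word_action f v"
  by (induction u) (simp_all add: comp_assoc)

lemma word_action_cong:
  assumes "\<And>i. i \<le> 8 \<Longrightarrow> f i \<circ> f i = id"
    and "\<And>i j. i \<le> 8 \<Longrightarrow> j \<le> 8 \<Longrightarrow> {i, j} \<in> E8_edges \<Longrightarrow> (f i \<circ> f j) ^^ 3 = id"
    and "\<And>i j. i \<le> 8 \<Longrightarrow> j \<le> 8 \<Longrightarrow> i \<noteq> j \<Longrightarrow> {i, j} \<notin> E8_edges \<Longrightarrow> (f i \<circ> f j) ^^ 2 = id"
    and "(u, v) \<in> word_rel {..8} E8_relators"
  shows "word_action f u = word_action f v"
  using assms(4)
proof (induction rule: word_rel.induct)
  case (relator r)
  then consider i where "i \<le> 8" "r = [(i, True), (i, True)]"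
    | i j where "i \<le> 8" "j \<le> 8" "{i, j} \<in> E8_edges" "r = concat (replicate 3 [(i, True), (j, True)])"
    | i j where "i \<le> 8" "j \<le> 8" "i \<noteq> j" "{i, j} \<notin> E8_edges" "r = concat (replicate 2 [(i, True), (j, True)])"
    unfolding E8_relators_def by blast
  then show ?case
  proof cases
    case 1
    then show ?thesis using assms(1) by simp
  next
    case 2
    then show ?thesis using assms(2)[of i j] by (simp add: numeral_3_eq_3 comp_assoc)
  next
    case 3
    then show ?thesis using assms(3)[of i j] by (simp add: numeral_2_eq_2 comp_assoc)
  qed
qed (use assms(1) in \<open>simp_all add: word_action_append\<close>)

lemma word_action_reflection_cong:
  assumes "(u, v) \<in> word_rel {..8} E8_relators"
  shows "word_action reflection u = word_action reflection v"
proof (rule word_action_cong[OF _ _ _ assms])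
  fix i j :: nat assume "i \<le> 8" "j \<le> 8" "{i, j} \<in> E8_edges"
  then show "(reflection i \<circ> reflection j) ^^ 3 = id"
    by (intro braid_imp_order_3 reflection_comp_reflection reflection_braid cox_edge)
next
  fix i j :: nat assume "i \<le> 8" "j \<le> 8" "i \<noteq> j" "{i, j} \<notin> E8_edges"
  then show "(reflection i \<circ> reflection j) ^^ 2 = id"
    by (intro commute_imp_order_2 reflection_comp_reflection reflection_commute cox_nonedge)
qed (rule reflection_comp_reflection)

section \<open>Faithfulness of the reflection representation\<close>

lemma E8_relators_subset: "E8_relators \<subseteq> words {..8}"
  by (auto simp: E8_relators_def words_def numeral_3_eq_3 numeral_2_eq_2)

text \<open>Modulo the squares every word is equivalent to one without inverse letters, so the
  length argument can work with lists of nodes.\<close>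

definition pos :: "nat list \<Rightarrow> (nat \<times> bool) list" where
  "pos xs = map (\<lambda>i. (i, True)) xs"

definition weq :: "nat list \<Rightarrow> nat list \<Rightarrow> bool" where
  "weq xs ys \<longleftrightarrow> (pos xs, pos ys) \<in> word_rel {..8} E8_relators"

lemma weq_refl: "xs \<in> lists {..8} \<Longrightarrow> weq xs xs"
  by (auto simp: weq_def pos_def words_def intro!: word_rel.refl)

lemma weq_sym: "weq xs ys \<Longrightarrow> weq ys xs"
  unfolding weq_def by (rule word_rel.sym)

lemma weq_trans [trans]: "weq xs ys \<Longrightarrow> weq ys zs \<Longrightarrow> weq xs zs"
  unfolding weq_def by (rule word_rel.trans)

lemma weq_append: "weq xs ys \<Longrightarrow> weq xs' ys' \<Longrightarrow> weq (xs @ xs') (ys @ ys')"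
  unfolding weq_def pos_def map_append by (rule word_rel.append)

lemma weq_append1: "weq xs ys \<Longrightarrow> zs \<in> lists {..8} \<Longrightarrow> weq (xs @ zs) (ys @ zs)"
  by (intro weq_append weq_refl)

lemma weq_append2: "weq xs ys \<Longrightarrow> zs \<in> lists {..8} \<Longrightarrow> weq (zs @ xs) (zs @ ys)"
  by (intro weq_append weq_refl)

lemma weq_square: "i \<le> 8 \<Longrightarrow> weq [i, i] []"
  by (auto simp: weq_def pos_def E8_relators_def intro!: word_rel.relator)

lemma weq_cancel: "i \<le> 8 \<Longrightarrow> xs \<in> lists {..8} \<Longrightarrow> weq (xs @ [i, i]) xs"
  using weq_append2[OF weq_square] by force

lemma weq_order_3: "i \<le> 8 \<Longrightarrow> j \<le> 8 \<Longrightarrow> {i, j} \<in> E8_edges \<Longrightarrow> weq [i, j, i, j, i, j] []"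
proof -
  assume *: "i \<le> 8" "j \<le> 8" "{i, j} \<in> E8_edges"
  have "pos [i, j, i, j, i, j] = concat (replicate 3 [(i, True), (j, True)])"
    by (simp add: pos_def numeral_3_eq_3)
  then have "pos [i, j, i, j, i, j] \<in> E8_relators"
    using * unfolding E8_relators_def by blast
  then show ?thesis using word_rel.relator by (fastforce simp: weq_def pos_def)
qed

lemma weq_order_2:
  "i \<le> 8 \<Longrightarrow> j \<le> 8 \<Longrightarrow> i \<noteq> j \<Longrightarrow> {i, j} \<notin> E8_edges \<Longrightarrow> weq [i, j, i, j] []"
proof -
  assume *: "i \<le> 8" "j \<le> 8" "i \<noteq> j" "{i, j} \<notin> E8_edges"
  have "pos [i, j, i, j] = concat (replicate 2 [(i, True), (j, True)])"
    by (simp add: pos_def numeral_2_eq_2)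
  then have "pos [i, j, i, j] \<in> E8_relators"
    using * unfolding E8_relators_def by blast
  then show ?thesis using word_rel.relator by (fastforce simp: weq_def pos_def)
qed

lemma weq_palindrome: "xs \<in> lists {..8} \<Longrightarrow> weq (xs @ rev xs) []"
proof (induction xs)
  case (Cons i xs)
  then have "weq ([i] @ (xs @ rev xs) @ [i]) ([i] @ [] @ [i])"
    by (intro weq_append weq_refl) auto
  also have "weq ([i] @ [] @ [i]) []"
    using Cons.prems weq_square by simp
  finally show ?case by simp
qed (simp add: weq_refl)

lemma weq_of_product:
  assumes "weq (xs @ rev ys) []" "xs \<in> lists {..8}" "ys \<in> lists {..8}"
  shows "weq xs ys"
proof -
  have "weq ((xs @ rev ys) @ ys) (xs @ [])"
    unfolding append_assoc using weq_palindrome[of "rev ys"] assms by (intro weq_append2) (auto simp: in_lists_conv_set)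
  then have "weq xs ((xs @ rev ys) @ ys)"
    unfolding append_Nil2 by (rule weq_sym)
  also have "weq \<dots> ([] @ ys)"
    by (intro weq_append1 assms)
  finally show ?thesis by simp
qed

lemma weq_braid:
  assumes "i \<le> 8" "j \<le> 8" "{i, j} \<in> E8_edges"
  shows "weq [i, j, i] [j, i, j]"
  using weq_of_product[of "[i, j, i]" "[j, i, j]"] weq_order_3 assms by simp

lemma weq_commute:
  assumes "i \<le> 8" "j \<le> 8" "i \<noteq> j" "{i, j} \<notin> E8_edges"
  shows "weq [i, j] [j, i]"
  using weq_of_product[of "[i, j]" "[j, i]"] weq_order_2 assms by simp

lemma weq_lists:
  assumes "weq xs ys"
  shows "xs \<in> lists {..8}" "ys \<in> lists {..8}"
proof -
  have "pos xs \<in> words {..8} \<and> pos ys \<in> words {..8}"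
    using assms word_rel_subset[OF E8_relators_subset] unfolding weq_def by blast
  then show "xs \<in> lists {..8}" "ys \<in> lists {..8}"
    by (auto simp: pos_def words_def)
qed

text \<open>The Coxeter length of the group element represented by the list, not the length of the
  list.\<close>

definition len :: "nat list \<Rightarrow> nat" where
  "len xs = (LEAST n. \<exists>ys. weq xs ys \<and> length ys = n)"

lemma ex_reduced:
  assumes "xs \<in> lists {..8}"
  obtains ys where "weq xs ys" "length ys = len xs"
proof -
  have "\<exists>ys. weq xs ys \<and> length ys = len xs"
    unfolding len_def by (rule LeastI[of _ "length xs"]) (use weq_refl assms in blast)
  then show thesis using that by blast
qed

lemma len_le: "weq xs ys \<Longrightarrow> len xs \<le> length ys"
  unfolding len_def by (rule Least_le) blast

lemma len_mono: "weq xs ys \<Longrightarrow> len xs \<le> len ys"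
proof -
  assume *: "weq xs ys"
  obtain zs where "weq ys zs" "length zs = len ys"
    using ex_reduced weq_lists(2)[OF *] by blast
  then show ?thesis using len_le[OF weq_trans[OF *]] by metis
qed

lemma len_cong: "weq xs ys \<Longrightarrow> len xs = len ys"
  by (rule antisym[OF len_mono len_mono[OF weq_sym]])

lemma len_append_le: "xs \<in> lists {..8} \<Longrightarrow> zs \<in> lists {..8} \<Longrightarrow> len (xs @ zs) \<le> len xs + length zs"
proof -
  assume *: "xs \<in> lists {..8}" "zs \<in> lists {..8}"
  then obtain ys where "weq xs ys" "length ys = len xs" using ex_reduced by blast
  then show ?thesis using len_le[of "xs @ zs" "ys @ zs"] weq_append1 * by simp
qed

abbreviation act :: "nat list \<Rightarrow> (nat \<Rightarrow> int) \<Rightarrow> nat \<Rightarrow> int" where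
  "act xs \<equiv> word_action reflection (pos xs)"

lemma act_cong: "weq xs ys \<Longrightarrow> act xs = act ys"
  unfolding weq_def by (rule word_action_reflection_cong)

lemma act_simps: "act [] = id" "act (i # xs) = reflection i \<circ> act xs"
  "act (xs @ ys) = act xs \<circ> act ys"
  by (simp_all add: pos_def word_action_append)

lemma act_add: "act xs (\<lambda>k. u k + v k) = (\<lambda>k. act xs u k + act xs v k)"
  by (induction xs) (simp_all add: act_simps reflection_add)

lemma act_uminus: "act xs (\<lambda>k. - v k) = (\<lambda>k. - act xs v k)"
  by (induction xs) (simp_all add: act_simps reflection_uminus)

lemma reflection_root_self: "i \<le> 8 \<Longrightarrow> reflection i (simple_root i) = (\<lambda>k. - simple_root i k)"
  by (simp add: reflection_def pair_root cox_def fun_eq_iff)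

lemma reflection_root_edge:
  "i \<le> 8 \<Longrightarrow> j \<le> 8 \<Longrightarrow> {i, j} \<in> E8_edges \<Longrightarrow> reflection i (simple_root j) = (\<lambda>k. simple_root j k + simple_root i k)"
  by (simp add: reflection_def pair_root cox_edge fun_eq_iff)

lemma reflection_root_nonedge:
  "i \<le> 8 \<Longrightarrow> j \<le> 8 \<Longrightarrow> i \<noteq> j \<Longrightarrow> {i, j} \<notin> E8_edges \<Longrightarrow> reflection i (simple_root j) = simple_root j"
  by (simp add: reflection_def pair_root cox_nonedge fun_eq_iff)

text \<open>If \<open>t\<close> is the last letter of a reduced word of \<open>w = v t\<close>, then the claim for \<open>w\<close> and \<open>\<alpha>\<^sub>i\<close>
  follows from the claim for \<open>v\<close> (and, if \<open>i\<close> and \<open>t\<close> are joined, possibly for \<open>v i\<close>);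
  the alternative would shorten \<open>w i\<close> by a braid move.\<close>

lemma act_root_nonneg:
  assumes "xs \<in> lists {..8}" "i \<le> 8" "len xs \<le> len (xs @ [i])"
  shows "0 \<le> act xs (simple_root i) k"
  using assms
proof (induction "len xs" arbitrary: xs i rule: less_induct)
  case less
  note xs = \<open>xs \<in> lists {..8}\<close>
  obtain ys where ys: "weq xs ys" "length ys = len xs" using ex_reduced xs by blast
  have ys_lists: "ys \<in> lists {..8}" using weq_lists(2) ys(1) by blast
  show ?case
  proof (cases ys rule: rev_cases)
    case Nil
    then show ?thesis using act_cong[OF ys(1)] by (simp add: act_simps simple_root_def)
  next
    case (snoc zs t)
    have zs: "zs \<in> lists {..8}" and t: "t \<le> 8" using ys_lists snoc by auto
    have xs_zs: "weq xs (zs @ [t])" using ys snoc by simp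
    have len_zs: "len xs = Suc (len zs)"
    proof (rule antisym)
      show "len xs \<le> Suc (len zs)"
        using len_append_le[of zs "[t]"] len_cong[OF xs_zs] zs t by simp
      have "len zs \<le> length zs" using len_le weq_refl zs by blast
      then show "Suc (len zs) \<le> len xs" using ys snoc by simp
    qed
    have "weq (xs @ [t]) (zs @ [t] @ [t])"
      using weq_append1[OF xs_zs, of "[t]"] t by simp
    also have "weq \<dots> zs" using weq_cancel zs t by simp
    finally have "i \<noteq> t"
      using len_cong less.prems(3) len_zs by fastforce
    have xs_s: "weq (xs @ [i]) (zs @ [t, i])"
      using weq_append1[OF xs_zs, of "[i]"] less.prems by simp
    show ?thesis
    proof (cases "{t, i} \<in> E8_edges")
      case False
      have "weq (zs @ [t, i]) (zs @ [i, t])"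
        using weq_append2[OF weq_commute] t less.prems \<open>i \<noteq> t\<close> False zs by blast
      with xs_s have "weq (xs @ [i]) ((zs @ [i]) @ [t])"
        using weq_trans by simp
      then have "len (xs @ [i]) \<le> Suc (len (zs @ [i]))"
        using len_cong len_append_le[of "zs @ [i]" "[t]"] zs t less.prems by fastforce
      then have "0 \<le> act zs (simple_root i) k"
        using less.hyps[of zs i] len_zs zs less.prems by simp
      then show ?thesis
        using act_cong[OF xs_zs] t less.prems False \<open>i \<noteq> t\<close>
        by (simp add: act_simps reflection_root_nonedge)
    next
      case True
      have act_xs: "act xs (simple_root i) k = act zs (simple_root i) k + act zs (simple_root t) k"
        using act_cong[OF xs_zs] t less.prems True by (simp add: act_simps reflection_root_edge act_add)
      have zs_t: "0 \<le> act zs (simple_root t) k"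
        using less.hyps[of zs t] len_zs len_cong[OF xs_zs] zs t by simp
      show ?thesis
      proof (cases "len zs \<le> len (zs @ [i])")
        case True
        then have "0 \<le> act zs (simple_root i) k"
          using less.hyps[of zs i] len_zs zs less.prems by simp
        then show ?thesis using act_xs zs_t by simp
      next
        case False
        let ?u = "zs @ [i]"
        have u: "?u \<in> lists {..8}" using zs less.prems by simp
        have "weq (xs @ [i]) (?u @ [i] @ [t, i])"
        proof -
          have "weq (zs @ [i, i] @ [t, i]) (zs @ [t, i])"
            using weq_append1[OF weq_cancel[of i zs], of "[t, i]"] zs t less.prems by simp
          then show ?thesis using weq_trans[OF xs_s weq_sym] by simp
        qed
        also have "weq \<dots> (?u @ [t, i, t])"
          using weq_append2[OF weq_braid[of i t] u] less.prems t True by (simp add: insert_commute)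
        \<comment> \<open>As \<open>len ?u < len zs\<close> and
          \<open>len xs = len zs + 1 \<le> len (xs @ [i])\<close>, this bound gives
          \<open>len ?u \<le> len (?u @ [t])\<close>, the hypothesis for induction at
          \<open>?u\<close>.\<close>
        finally have "len (xs @ [i]) \<le> len (?u @ [t]) + 2"
          using len_cong len_append_le[of "?u @ [t]" "[i, t]"] u t less.prems by fastforce
        then have "0 \<le> act ?u (simple_root t) k"
          using less.hyps[of ?u t] len_zs False u t less.prems by simp
        also have "act ?u (simple_root t) k = act zs (\<lambda>k. simple_root t k + simple_root i k) k"
          using True less.prems t by (simp add: act_simps reflection_root_edge insert_commute)
        finally show ?thesis using act_xs by (simp add: act_add)
      qed
    qed
  qed
qed

text \<open>If a reduced word ended in \<open>t\<close>, say as \<open>z t\<close>, the t-th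
  coefficient of the image of the t-th simple root would be the negative of a nonnegative number,
  whereas it is 1. So the reduced word is empty.\<close>

lemma act_faithful:
  assumes xs: "xs \<in> lists {..8}" and trivial: "\<And>j. j \<le> 8 \<Longrightarrow> act xs (simple_root j) = simple_root j"
  shows "weq xs []"
proof -
  obtain ys where ys: "weq xs ys" "length ys = len xs" using ex_reduced xs by blast
  show ?thesis
  proof (cases ys rule: rev_cases)
    case Nil
    then show ?thesis using ys by simp
  next
    case (snoc zs t)
    then have zs: "zs \<in> lists {..8}" and t: "t \<le> 8" using weq_lists[OF ys(1)] by auto
    have "len zs \<le> length zs" using len_le weq_refl zs by blast
    then have "len zs \<le> len (zs @ [t])"
      using ys snoc len_cong[OF ys(1)] by simp
    then have "0 \<le> act zs (simple_root t) t"
      using act_root_nonneg zs t by blast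
    moreover have "act xs (simple_root t) t = - act zs (simple_root t) t"
      using act_cong[OF ys(1)] snoc t by (simp add: act_simps reflection_root_self act_uminus)
    ultimately show ?thesis
      using trivial[OF t] by (simp add: simple_root_def)
  qed
qed

section \<open>Invariance of the Hamiltonian under each reflection of the parameters\<close>

lemma beta_explicit:
  fixes \<alpha> :: "nat \<Rightarrow> 'a::comm_ring_1"
  defines "r1 \<equiv> \<rho> \<alpha> 1"
  defines "r2 \<equiv> \<rho> \<alpha> 2"
  defines "r3 \<equiv> \<rho> \<alpha> 3"
  defines "r4 \<equiv> \<rho> \<alpha> 4"
  defines "r5 \<equiv> \<rho> \<alpha> 5"
  shows "\<beta> \<alpha> 1 = r1 + r2 + r3 + r4 + r5"
    and "\<beta> \<alpha> 2 = r1 * r2 + r1 * r3 + r1 * r4 + r1 * r5 + r2 * r3 + r2 * r4 + r2 * r5 + r3 * r4 + r3 * r5 + r4 * r5"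
    and "\<beta> \<alpha> 3 = r1 * r2 * r3 + r1 * r2 * r4 + r1 * r2 * r5 + r1 * r3 * r4 + r1 * r3 * r5 + r1 * r4 * r5
      + r2 * r3 * r4 + r2 * r3 * r5 + r2 * r4 * r5 + r3 * r4 * r5"
    and "\<beta> \<alpha> 4 = r1 * r2 * r3 * r4 + r1 * r2 * r3 * r5 + r1 * r2 * r4 * r5 + r1 * r3 * r4 * r5 + r2 * r3 * r4 * r5"
    and "\<beta> \<alpha> 5 = r1 * r2 * r3 * r4 * r5"
  by (simp_all add: beta_conv_esym esym_simps r1_def r2_def r3_def r4_def r5_def
    algebra_simps)

lemma rho_explicit:
  fixes \<alpha> :: "nat \<Rightarrow> 'a::comm_ring_1"
  shows "\<rho> \<alpha> 1 = \<alpha> 1" "\<rho> \<alpha> 2 = \<alpha> 1 + \<alpha> 2" "\<rho> \<alpha> 3 = \<alpha> 1 + \<alpha> 2 + \<alpha> 3"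
    "\<rho> \<alpha> 4 = \<alpha> 1 + \<alpha> 2 + \<alpha> 3 + \<alpha> 4" "\<rho> \<alpha> 5 = \<alpha> 1 + \<alpha> 2 + \<alpha> 3 + \<alpha> 4 + \<alpha> 5"
proof -
  have Suc: "\<rho> \<alpha> (Suc k) = \<rho> \<alpha> k + \<alpha> (Suc k)" for k
    by (simp add: \<rho>_def)
  show 1: "\<rho> \<alpha> 1 = \<alpha> 1" by (simp add: \<rho>_def)
  show 2: "\<rho> \<alpha> 2 = \<alpha> 1 + \<alpha> 2" using Suc[of 1] 1 by (simp add: numeral_2_eq_2)
  show 3: "\<rho> \<alpha> 3 = \<alpha> 1 + \<alpha> 2 + \<alpha> 3" using Suc[of 2] 2 by simp
  show 4: "\<rho> \<alpha> 4 = \<alpha> 1 + \<alpha> 2 + \<alpha> 3 + \<alpha> 4" using Suc[of 3] 3 by simp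
  show "\<rho> \<alpha> 5 = \<alpha> 1 + \<alpha> 2 + \<alpha> 3 + \<alpha> 4 + \<alpha> 5" using Suc[of 4] 4 by simp
qed

lemma ham_cong:
  fixes \<alpha> \<alpha>' :: "nat \<Rightarrow> 'a::comm_ring_1"
  assumes "\<kappa> \<alpha>' = \<kappa> \<alpha>" "\<epsilon> \<alpha>' = \<epsilon> \<alpha>" "\<gamma>1 \<alpha>' = \<gamma>1 \<alpha>" "\<gamma>2 \<alpha>' = \<gamma>2 \<alpha>"
    and "\<beta> \<alpha>' 1 = \<beta> \<alpha> 1" "\<beta> \<alpha>' 2 = \<beta> \<alpha> 2" "\<beta> \<alpha>' 3 = \<beta> \<alpha> 3" "\<beta> \<alpha>' 4 = \<beta> \<alpha> 4" "\<beta> \<alpha>' 5 = \<beta> \<alpha> 5"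
  shows "ham \<alpha>' q p = ham \<alpha> q p"
  unfolding ham_def coeff_defs assms ..

lemma ham_conv_F:
  fixes \<alpha> :: "nat \<Rightarrow> 'a::idom"
  shows "q * ham \<alpha> q p = F0 \<alpha> (q * p) + F1 \<alpha> (q * p) * q + F2 \<alpha> (q * p) * q^2
    + F3 \<alpha> (q * p) * q^3 + F4 \<alpha> (q * p) * q^4"
  unfolding ham_def expansion_defs by algebra

lemma ham_conv_K:
  fixes \<alpha> :: "nat \<Rightarrow> 'a::idom" and q p :: 'a
  defines "r \<equiv> q - 1"
  shows "r^2 * ham \<alpha> q p = K0 \<alpha> (r * p) + K1 \<alpha> (r * p) * r + K2 \<alpha> (r * p) * r^2
    + K3 \<alpha> (r * p) * r^3 + K4 \<alpha> (r * p) * r^4 + F4 \<alpha> (r * p) * r^5"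
  unfolding ham_def expansion_defs r_def by algebra

definition reflected :: "nat \<Rightarrow> (nat \<Rightarrow> 'a::comm_ring_1) \<Rightarrow> nat \<Rightarrow> 'a" where
  "reflected i \<alpha> j = \<alpha> j + of_int (cox i j) * \<alpha> i"

lemmas cox_eval = cox_def E8_edges_def doubleton_eq_iff

lemma reflected_eval:
  fixes \<alpha> :: "nat \<Rightarrow> 'a::comm_ring_1"
  shows
    "reflected 0 \<alpha> 0 = - \<alpha> 0" "reflected 0 \<alpha> 1 = \<alpha> 1 + \<alpha> 0" "reflected 0 \<alpha> 2 = \<alpha> 2"
    "reflected 0 \<alpha> 3 = \<alpha> 3" "reflected 0 \<alpha> 4 = \<alpha> 4" "reflected 0 \<alpha> 5 = \<alpha> 5"
    "reflected 0 \<alpha> 6 = \<alpha> 6 + \<alpha> 0" "reflected 0 \<alpha> 7 = \<alpha> 7" "reflected 0 \<alpha> 8 = \<alpha> 8 + \<alpha> 0"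
    "reflected 1 \<alpha> 0 = \<alpha> 0 + \<alpha> 1" "reflected 1 \<alpha> 1 = - \<alpha> 1" "reflected 1 \<alpha> 2 = \<alpha> 2 + \<alpha> 1"
    "reflected 1 \<alpha> 3 = \<alpha> 3" "reflected 1 \<alpha> 4 = \<alpha> 4" "reflected 1 \<alpha> 5 = \<alpha> 5"
    "reflected 1 \<alpha> 6 = \<alpha> 6" "reflected 1 \<alpha> 7 = \<alpha> 7" "reflected 1 \<alpha> 8 = \<alpha> 8"
    "reflected 2 \<alpha> 0 = \<alpha> 0" "reflected 2 \<alpha> 1 = \<alpha> 1 + \<alpha> 2" "reflected 2 \<alpha> 2 = - \<alpha> 2"
    "reflected 2 \<alpha> 3 = \<alpha> 3 + \<alpha> 2" "reflected 2 \<alpha> 4 = \<alpha> 4" "reflected 2 \<alpha> 5 = \<alpha> 5"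
    "reflected 2 \<alpha> 6 = \<alpha> 6" "reflected 2 \<alpha> 7 = \<alpha> 7" "reflected 2 \<alpha> 8 = \<alpha> 8"
    "reflected 3 \<alpha> 0 = \<alpha> 0" "reflected 3 \<alpha> 1 = \<alpha> 1" "reflected 3 \<alpha> 2 = \<alpha> 2 + \<alpha> 3"
    "reflected 3 \<alpha> 3 = - \<alpha> 3" "reflected 3 \<alpha> 4 = \<alpha> 4 + \<alpha> 3" "reflected 3 \<alpha> 5 = \<alpha> 5"
    "reflected 3 \<alpha> 6 = \<alpha> 6" "reflected 3 \<alpha> 7 = \<alpha> 7" "reflected 3 \<alpha> 8 = \<alpha> 8"
    "reflected 4 \<alpha> 0 = \<alpha> 0" "reflected 4 \<alpha> 1 = \<alpha> 1" "reflected 4 \<alpha> 2 = \<alpha> 2"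
    "reflected 4 \<alpha> 3 = \<alpha> 3 + \<alpha> 4" "reflected 4 \<alpha> 4 = - \<alpha> 4" "reflected 4 \<alpha> 5 = \<alpha> 5 + \<alpha> 4"
    "reflected 4 \<alpha> 6 = \<alpha> 6" "reflected 4 \<alpha> 7 = \<alpha> 7" "reflected 4 \<alpha> 8 = \<alpha> 8"
    "reflected 5 \<alpha> 0 = \<alpha> 0" "reflected 5 \<alpha> 1 = \<alpha> 1" "reflected 5 \<alpha> 2 = \<alpha> 2"
    "reflected 5 \<alpha> 3 = \<alpha> 3" "reflected 5 \<alpha> 4 = \<alpha> 4 + \<alpha> 5" "reflected 5 \<alpha> 5 = - \<alpha> 5"
    "reflected 5 \<alpha> 6 = \<alpha> 6" "reflected 5 \<alpha> 7 = \<alpha> 7" "reflected 5 \<alpha> 8 = \<alpha> 8"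
    "reflected 6 \<alpha> 0 = \<alpha> 0 + \<alpha> 6" "reflected 6 \<alpha> 1 = \<alpha> 1" "reflected 6 \<alpha> 2 = \<alpha> 2"
    "reflected 6 \<alpha> 3 = \<alpha> 3" "reflected 6 \<alpha> 4 = \<alpha> 4" "reflected 6 \<alpha> 5 = \<alpha> 5"
    "reflected 6 \<alpha> 6 = - \<alpha> 6" "reflected 6 \<alpha> 7 = \<alpha> 7 + \<alpha> 6" "reflected 6 \<alpha> 8 = \<alpha> 8"
    "reflected 7 \<alpha> 0 = \<alpha> 0" "reflected 7 \<alpha> 1 = \<alpha> 1" "reflected 7 \<alpha> 2 = \<alpha> 2"
    "reflected 7 \<alpha> 3 = \<alpha> 3" "reflected 7 \<alpha> 4 = \<alpha> 4" "reflected 7 \<alpha> 5 = \<alpha> 5"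
    "reflected 7 \<alpha> 6 = \<alpha> 6 + \<alpha> 7" "reflected 7 \<alpha> 7 = - \<alpha> 7" "reflected 7 \<alpha> 8 = \<alpha> 8"
    "reflected 8 \<alpha> 0 = \<alpha> 0 + \<alpha> 8" "reflected 8 \<alpha> 1 = \<alpha> 1" "reflected 8 \<alpha> 2 = \<alpha> 2"
    "reflected 8 \<alpha> 3 = \<alpha> 3" "reflected 8 \<alpha> 4 = \<alpha> 4" "reflected 8 \<alpha> 5 = \<alpha> 5"
    "reflected 8 \<alpha> 6 = \<alpha> 6" "reflected 8 \<alpha> 7 = \<alpha> 7" "reflected 8 \<alpha> 8 = - \<alpha> 8"
  by (simp_all add: reflected_def cox_eval)

lemma rho_reflected:
  fixes \<alpha> :: "nat \<Rightarrow> 'a::comm_ring_1"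
  shows
    "\<rho> (reflected 2 \<alpha>) 1 = \<rho> \<alpha> 2" "\<rho> (reflected 2 \<alpha>) 2 = \<rho> \<alpha> 1" "\<rho> (reflected 2 \<alpha>) 3 = \<rho> \<alpha> 3"
    "\<rho> (reflected 2 \<alpha>) 4 = \<rho> \<alpha> 4" "\<rho> (reflected 2 \<alpha>) 5 = \<rho> \<alpha> 5"
    "\<rho> (reflected 3 \<alpha>) 1 = \<rho> \<alpha> 1" "\<rho> (reflected 3 \<alpha>) 2 = \<rho> \<alpha> 3" "\<rho> (reflected 3 \<alpha>) 3 = \<rho> \<alpha> 2"
    "\<rho> (reflected 3 \<alpha>) 4 = \<rho> \<alpha> 4" "\<rho> (reflected 3 \<alpha>) 5 = \<rho> \<alpha> 5"
    "\<rho> (reflected 4 \<alpha>) 1 = \<rho> \<alpha> 1" "\<rho> (reflected 4 \<alpha>) 2 = \<rho> \<alpha> 2" "\<rho> (reflected 4 \<alpha>) 3 = \<rho> \<alpha> 4"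
    "\<rho> (reflected 4 \<alpha>) 4 = \<rho> \<alpha> 3" "\<rho> (reflected 4 \<alpha>) 5 = \<rho> \<alpha> 5"
    "\<rho> (reflected 5 \<alpha>) 1 = \<rho> \<alpha> 1" "\<rho> (reflected 5 \<alpha>) 2 = \<rho> \<alpha> 2" "\<rho> (reflected 5 \<alpha>) 3 = \<rho> \<alpha> 3"
    "\<rho> (reflected 5 \<alpha>) 4 = \<rho> \<alpha> 5" "\<rho> (reflected 5 \<alpha>) 5 = \<rho> \<alpha> 4"
    "\<rho> (reflected 7 \<alpha>) 1 = \<rho> \<alpha> 1" "\<rho> (reflected 7 \<alpha>) 2 = \<rho> \<alpha> 2" "\<rho> (reflected 7 \<alpha>) 3 = \<rho> \<alpha> 3"
    "\<rho> (reflected 7 \<alpha>) 4 = \<rho> \<alpha> 4" "\<rho> (reflected 7 \<alpha>) 5 = \<rho> \<alpha> 5"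
    "\<rho> (reflected 8 \<alpha>) 1 = \<rho> \<alpha> 1" "\<rho> (reflected 8 \<alpha>) 2 = \<rho> \<alpha> 2" "\<rho> (reflected 8 \<alpha>) 3 = \<rho> \<alpha> 3"
    "\<rho> (reflected 8 \<alpha>) 4 = \<rho> \<alpha> 4" "\<rho> (reflected 8 \<alpha>) 5 = \<rho> \<alpha> 5"
  by (simp_all only: rho_explicit reflected_eval) (simp_all only: ac_simps add_minus_cancel minus_add_cancel
    add.right_inverse add_0_left)

text \<open>These reflections swap two neighbouring \<open>\<rho> k\<close> (nodes 2 to 5),
  \<open>\<alpha> 6\<close> with \<open>\<alpha> 6 + \<alpha> 7\<close> (node 7), or
  \<open>\<alpha> 0\<close> with \<open>\<alpha> 0 + \<alpha> 8\<close> (node 8); the coefficients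
  are symmetric in each of these groups.\<close>

lemma ham_reflected_neutral:
  fixes \<alpha> :: "nat \<Rightarrow> 'a::idom"
  assumes "i \<in> {2, 3, 4, 5, 7, 8}"
  shows "ham (reflected i \<alpha>) q p = ham \<alpha> q p"
proof (rule ham_cong)
  show "\<kappa> (reflected i \<alpha>) = \<kappa> \<alpha>" "\<gamma>1 (reflected i \<alpha>) = \<gamma>1 \<alpha>"
    using assms by (elim insertE emptyE; simp add: \<kappa>_def \<gamma>1_def reflected_eval)+
  show "\<epsilon> (reflected i \<alpha>) = \<epsilon> \<alpha>" "\<gamma>2 (reflected i \<alpha>) = \<gamma>2 \<alpha>"
    using assms by (elim insertE emptyE; simp add: \<epsilon>_def \<gamma>2_def reflected_eval mult.commute)+
  show "\<beta> (reflected i \<alpha>) 1 = \<beta> \<alpha> 1" "\<beta> (reflected i \<alpha>) 2 = \<beta> \<alpha> 2" "\<beta> (reflected i \<alpha>) 3 = \<beta> \<alpha> 3"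
    "\<beta> (reflected i \<alpha>) 4 = \<beta> \<alpha> 4" "\<beta> (reflected i \<alpha>) 5 = \<beta> \<alpha> 5"
    using assms by (elim insertE emptyE; simp only: beta_explicit rho_reflected ac_simps)+
qed

lemma beta_1_relation:
  fixes \<alpha> :: "nat \<Rightarrow> 'a::idom"
  assumes "6 * \<alpha> 0 + 5 * \<alpha> 1 + 4 * \<alpha> 2 + 3 * \<alpha> 3 + 2 * \<alpha> 4 + \<alpha> 5 + 4 * \<alpha> 6 + 2 * \<alpha> 7 + 3 * \<alpha> 8 = 0"
  shows "\<beta> \<alpha> 1 = - 3 * \<kappa> \<alpha> - 2 * \<gamma>1 \<alpha>"
proof -
  have "\<beta> \<alpha> 1 + 3 * \<kappa> \<alpha> + 2 * \<gamma>1 \<alpha> =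
    6 * \<alpha> 0 + 5 * \<alpha> 1 + 4 * \<alpha> 2 + 3 * \<alpha> 3 + 2 * \<alpha> 4 + \<alpha> 5 + 4 * \<alpha> 6 + 2 * \<alpha> 7 + 3 * \<alpha> 8"
    by (simp add: beta_explicit rho_explicit \<kappa>_def \<gamma>1_def algebra_simps del: One_nat_def)
  then show ?thesis unfolding assms by algebra
qed

lemma ham_reflected_0:
  fixes \<alpha> :: "nat \<Rightarrow> 'a::field"
  assumes rel: "\<beta> \<alpha> 1 = - 3 * \<kappa> \<alpha> - 2 * \<gamma>1 \<alpha>"
    and nz: "q \<noteq> 0" "p \<noteq> 0" "q + \<alpha> 0 / p \<noteq> 0"
  shows "ham (reflected 0 \<alpha>) (q + \<alpha> 0 / p) p = ham \<alpha> q p + F1 (reflected 0 \<alpha>) (\<alpha> 0)"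
proof -
  let ?\<alpha> = "reflected 0 \<alpha>" and ?a = "\<alpha> 0" and ?u = "q * p"
  let ?Q = "q + ?a / p"
  have u: "?Q * p = ?u + ?a" using nz by (simp add: field_simps)
  have rho: "\<rho> ?\<alpha> k = \<rho> \<alpha> k + ?a" if "k \<in> {1, 2, 3, 4, 5}" for k
    using that by (elim insertE emptyE)
      (simp_all add: rho_explicit reflected_eval del: One_nat_def)
  have F: "?u * F0 ?\<alpha> (?u + ?a) = (?u + ?a) * F0 \<alpha> ?u"
    "F1 ?\<alpha> (?u + ?a) - F1 \<alpha> ?u = F1 ?\<alpha> ?a"
    "(?u + ?a) * F2 ?\<alpha> (?u + ?a) = ?u * F2 \<alpha> ?u"
    "(?u + ?a)^2 * F3 ?\<alpha> (?u + ?a) = ?u^2 * F3 \<alpha> ?u"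
    "(?u + ?a)^3 * F4 ?\<alpha> (?u + ?a) = ?u^3 * F4 \<alpha> ?u"
    by (intro F_shift_0 rel; simp add: \<kappa>_def \<epsilon>_def \<gamma>1_def \<gamma>2_def reflected_eval
        beta_explicit rho del: One_nat_def; algebra)+
  \<comment> \<open>Since p is fixed, powers of q are traded for powers of u = q p by multiplying
    with p.\<close>
  have "?u * p^3 * ham \<alpha> q p = p^4 * (q * ham \<alpha> q p)" by algebra
  also have "\<dots> = F0 \<alpha> ?u * p^4 + F1 \<alpha> ?u * ?u * p^3 + F2 \<alpha> ?u * ?u^2 * p^2
      + F3 \<alpha> ?u * ?u^3 * p + F4 \<alpha> ?u * ?u^4"
    unfolding ham_conv_F by algebra
  finally have 1: "?u * p^3 * ham \<alpha> q p = \<dots>" .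
  have "(?u + ?a) * p^3 * ham ?\<alpha> ?Q p = p^4 * (?Q * ham ?\<alpha> ?Q p)"
    unfolding u[symmetric] by algebra
  also have "\<dots> = F0 ?\<alpha> (?u + ?a) * p^4 + F1 ?\<alpha> (?u + ?a) * (?u + ?a) * p^3
      + F2 ?\<alpha> (?u + ?a) * (?u + ?a)^2 * p^2 + F3 ?\<alpha> (?u + ?a) * (?u + ?a)^3 * p
      + F4 ?\<alpha> (?u + ?a) * (?u + ?a)^4"
    unfolding ham_conv_F u[symmetric] by algebra
  finally have 2: "(?u + ?a) * p^3 * ham ?\<alpha> ?Q p = \<dots>" .
  define U U' where "U = ?u" and "U' = ?u + ?a"
  note F = F[folded U'_def, folded U_def] and 1 = 1[folded U_def] and 2 = 2[folded U'_def]
  \<comment> \<open>The factors \<open>U\<close> and \<open>U'\<close> come from clearing q on both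
    sides. The difference then splits into one bracket per coefficient, each of which vanishes by
    \<open>F\<close>.\<close>
  have "U * U' * p^3 * (ham ?\<alpha> ?Q p - ham \<alpha> q p - F1 ?\<alpha> ?a) =
      U * (U' * p^3 * ham ?\<alpha> ?Q p) - U' * (U * p^3 * ham \<alpha> q p) - U * U' * p^3 * F1 ?\<alpha> ?a"
    by algebra
  also have "\<dots> = p^4 * (U * F0 ?\<alpha> U' - U' * F0 \<alpha> U)
      + U * U' * p^3 * (F1 ?\<alpha> U' - F1 \<alpha> U - F1 ?\<alpha> ?a)
      + U * U' * p^2 * (U' * F2 ?\<alpha> U' - U * F2 \<alpha> U)
      + U * U' * p * (U'^2 * F3 ?\<alpha> U' - U^2 * F3 \<alpha> U)
      + U * U' * (U'^3 * F4 ?\<alpha> U' - U^3 * F4 \<alpha> U)"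
    unfolding 1 2 by algebra
  also have "\<dots> = 0" unfolding F by simp
  finally show ?thesis
    using nz u by (simp add: U_def U'_def) (metis add_diff_cancel_left' diff_eq_eq mult_eq_0_iff)
qed

lemma ham_reflected_1:
  fixes \<alpha> :: "nat \<Rightarrow> 'a::field"
  assumes rel: "\<beta> \<alpha> 1 = - 3 * \<kappa> \<alpha> - 2 * \<gamma>1 \<alpha>" and nz: "q \<noteq> 0"
  shows "ham (reflected 1 \<alpha>) q (p - \<alpha> 1 / q) = ham \<alpha> q p + F1 (reflected 1 \<alpha>) (- \<alpha> 1)"
proof -
  let ?\<alpha> = "reflected 1 \<alpha>" and ?a = "\<alpha> 1" and ?u = "q * p"
  have u: "q * (p - ?a / q) = ?u - ?a" using nz by (simp add: field_simps)
  have rho: "\<rho> ?\<alpha> k = \<rho> \<alpha> k - ?a" if "k \<in> {2, 3, 4, 5}" for k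
    using that by (elim insertE emptyE)
      (simp_all add: rho_explicit reflected_eval del: One_nat_def)
  have rho1: "\<rho> ?\<alpha> 1 = - ?a" "\<rho> \<alpha> 1 = ?a"
    by (simp_all add: rho_explicit reflected_eval del: One_nat_def)
  let ?e = "esym \<alpha> {5, 4, 3, 2}"
  have e1: "- 3 * \<kappa> \<alpha> - 2 * \<gamma>1 \<alpha> - ?a = ?e 1"
    unfolding rel[symmetric] by (simp add: beta_explicit esym_simps rho1 del: One_nat_def)
  have F: "F0 ?\<alpha> (?u - ?a) = F0 \<alpha> ?u" "F2 ?\<alpha> (?u - ?a) = F2 \<alpha> ?u"
    "F3 ?\<alpha> (?u - ?a) = F3 \<alpha> ?u" "F4 ?\<alpha> (?u - ?a) = F4 \<alpha> ?u"
    "F1 ?\<alpha> (?u - ?a) = F1 \<alpha> ?u + F1 ?\<alpha> (- ?a)"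
    by (rule F_shift_1[where ?e2.0 = "?e 2" and ?e3.0 = "?e 3" and ?e4.0 = "?e 4"], unfold e1,
        simp_all add: \<kappa>_def \<epsilon>_def \<gamma>1_def \<gamma>2_def reflected_eval
        beta_explicit rho rho1 esym_simps del: One_nat_def, algebra+)+
  have "q * ham ?\<alpha> q (p - ?a / q) = q * (ham \<alpha> q p + F1 ?\<alpha> (- ?a))"
    unfolding distrib_left ham_conv_F u F by algebra
  with nz show ?thesis by simp
qed

lemma ham_reflected_6:
  fixes \<alpha> :: "nat \<Rightarrow> 'a::field"
  assumes rel: "\<beta> \<alpha> 1 = - 3 * \<kappa> \<alpha> - 2 * \<gamma>1 \<alpha>" and nz: "q \<noteq> 1"
  shows "ham (reflected 6 \<alpha>) q (p - \<alpha> 6 / (q - 1)) =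
    ham \<alpha> q p + (K2 (reflected 6 \<alpha>) (- \<alpha> 6) - K2 \<alpha> 0)"
proof -
  let ?\<alpha> = "reflected 6 \<alpha>" and ?a = "\<alpha> 6" and ?v = "(q - 1) * p"
  have v: "(q - 1) * (p - ?a / (q - 1)) = ?v - ?a" using nz by (simp add: field_simps)
  have rho: "\<rho> ?\<alpha> k = \<rho> \<alpha> k" if "k \<in> {1, 2, 3, 4, 5}" for k
    using that by (elim insertE emptyE)
      (simp_all add: rho_explicit reflected_eval del: One_nat_def)
  have K: "K0 ?\<alpha> (?v - ?a) = K0 \<alpha> ?v" "K1 ?\<alpha> (?v - ?a) = K1 \<alpha> ?v"
    "K3 ?\<alpha> (?v - ?a) = K3 \<alpha> ?v" "K4 ?\<alpha> (?v - ?a) = K4 \<alpha> ?v" "F4 ?\<alpha> (?v - ?a) = F4 \<alpha> ?v"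
    "K2 ?\<alpha> (?v - ?a) + K2 \<alpha> 0 = K2 \<alpha> ?v + K2 ?\<alpha> (- ?a)"
    by (intro K_shift_6 rel; simp add: \<kappa>_def \<epsilon>_def \<gamma>1_def \<gamma>2_def reflected_eval
        beta_explicit rho del: One_nat_def; algebra)+
  then have K2: "K2 ?\<alpha> (?v - ?a) = K2 \<alpha> ?v + (K2 ?\<alpha> (- ?a) - K2 \<alpha> 0)"
    by (simp add: algebra_simps)
  have "(q - 1)^2 * ham ?\<alpha> q (p - ?a / (q - 1)) =
      (q - 1)^2 * (ham \<alpha> q p + (K2 ?\<alpha> (- ?a) - K2 \<alpha> 0))"
    unfolding distrib_left[of "(q - 1)^2"] ham_conv_K v K(1-5) K2 by algebra
  with nz show ?thesis by simp
qed

section \<open>The invariant form, its null vector and the weight\<close>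

definition form :: "(nat \<Rightarrow> int) \<Rightarrow> (nat \<Rightarrow> int) \<Rightarrow> int" where
  "form u v = (\<Sum>i\<le>8. u i * pair i v)"

text \<open>The coefficients of the linear relation between the parameters; this vector lies in the
  radical of \<open>form\<close>.\<close>

definition null_root :: "nat \<Rightarrow> int" where
  "null_root k = [6, 5, 4, 3, 2, 1, 4, 2, 3] ! k"

lemma le_8_cases:
  "i \<le> (8::nat) \<longleftrightarrow> i = 0 \<or> i = 1 \<or> i = 2 \<or> i = 3 \<or> i = 4 \<or> i = 5 \<or> i = 6 \<or> i = 7 \<or> i = 8"
  by linarith

lemma sum_atMost_8:
  "(\<Sum>k\<le>8. f k) = f 0 + f 1 + f 2 + f 3 + f 4 + f 5 + f 6 + f 7 + (f (8::nat) :: 'a::comm_monoid_add)"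
  by (simp add: eval_nat_numeral)

lemma form_add_left: "form (\<lambda>k. u k + v k) w = form u w + form v w"
  by (simp add: form_def ring_distribs sum.distrib)

lemma form_sym: "form u v = form v u"
proof -
  have "form u v = (\<Sum>i\<le>8. \<Sum>j\<le>8. u i * (cox i j * v j))"
    by (simp add: form_def pair_def sum_distrib_left)
  also have "\<dots> = (\<Sum>j\<le>8. \<Sum>i\<le>8. u i * (cox i j * v j))"
    by (rule sum.swap)
  also have "\<dots> = form v u"
    by (simp add: form_def pair_def sum_distrib_left cox_sym mult.left_commute mult.commute)
  finally show ?thesis .
qed

lemma form_root_left:
  assumes "i \<le> 8"
  shows "form (\<lambda>k. c * simple_root i k) v = c * pair i v"
proof -
  have "form (\<lambda>k. c * simple_root i k) v = (\<Sum>k\<le>8. if k = i then c * pair i v else 0)"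
    unfolding form_def by (rule sum.cong) (auto simp: simple_root_def)
  with assms show ?thesis by simp
qed

lemma form_reflection:
  assumes "i \<le> 8"
  shows "form (reflection i u) (reflection i v) = form u v"
proof -
  have left: "form (reflection i u) w = form u w + pair i u * pair i w" for u w
    unfolding reflection_def form_add_left using form_root_left[OF assms] by simp
  have "form (reflection i u) (reflection i v) = form (reflection i v) u + pair i u * pair i (reflection i v)"
    unfolding left[of u] by (simp only: form_sym)
  also have "\<dots> = form u v + pair i v * pair i u - pair i u * pair i v"
    unfolding left using assms by (simp add: pair_reflection cox_def form_sym)
  finally show ?thesis by simp
qed

lemma form_null_root: "(\<And>i. i \<le> 8 \<Longrightarrow> u i = m * null_root i) \<Longrightarrow> form u v = 0"
proof -
  assume u: "\<And>i. i \<le> 8 \<Longrightarrow> u i = m * null_root i"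
  have pair: "pair j u = 0" if "j \<le> 8" for j
  proof -
    have "pair j u = m * (\<Sum>k\<le>8. cox j k * null_root k)"
      unfolding pair_def sum_distrib_left by (rule sum.cong) (simp_all add: u)
    also have "(\<Sum>k\<le>8. cox j k * null_root k) = 0"
      using that unfolding le_8_cases sum_atMost_8
      by (elim disjE) (simp_all add: null_root_def cox_def E8_edges_def doubleton_eq_iff)
    finally show ?thesis by simp
  qed
  have "form u v = form v u" by (rule form_sym)
  also have "\<dots> = 0" by (simp add: form_def pair)
  finally show ?thesis .
qed

text \<open>With an additional weight \<open>\<Lambda>\<close> such that \<open>s\<^sub>i \<Lambda> = \<Lambda> + \<delta>\<^sub>i\<^sub>0 \<alpha>\<^sub>0\<close>, the value on a word \<open>w\<close> is
  \<open>w \<Lambda> - \<Lambda>\<close>.\<close>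

fun weight_shift :: "nat list \<Rightarrow> nat \<Rightarrow> int" where
  "weight_shift [] = (\<lambda>_. 0)"
| "weight_shift (i # xs) =
    (\<lambda>k. reflection i (weight_shift xs) k + (if i = 0 then simple_root 0 k else 0))"

text \<open>\<open>weight_shift\<close> recurses on the first letter, whereas the series expansion
  appends letters at the end. For w followed by the letter 0 the weight is moved to w \<Lambda> + w
  \<open>\<alpha> 0\<close>.\<close>

lemma weight_shift_snoc:
  "weight_shift (xs @ [i]) =
    (\<lambda>k. weight_shift xs k + (if i = 0 then act xs (simple_root 0) k else 0))"
proof (induction xs)
  case Nil
  show ?case by (cases "i = 0") (simp_all add: act_simps reflection_def pair_def)
next
  case (Cons j xs)
  then show ?case
    by (cases "i = 0") (simp_all add: act_simps reflection_add add_ac)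
qed

text \<open>This is \<open>(w \<Lambda>, w v) = (\<Lambda>, v)\<close>, where \<open>(\<Lambda>, v) = - v 0\<close> and \<open>form\<close> is the negative of the invariant
  bilinear form.\<close>

lemma act_weight_shift:
  assumes "xs \<in> lists {..8}"
  shows "act xs v 0 = v 0 - form (weight_shift xs) (act xs v)"
  using assms
proof (induction xs)
  case Nil
  show ?case by (simp add: act_simps form_def)
next
  case (Cons i xs)
  let ?u = "act xs v"
  have i: "i \<le> 8" using Cons.hyps by simp
  have "form (weight_shift (i # xs)) (reflection i ?u) =
      form (weight_shift xs) ?u + (if i = 0 then pair 0 (reflection 0 ?u) else 0)"
    using form_root_left[of 0 1 "reflection 0 ?u"] form_reflection[OF i]
    by (cases "i = 0") (simp_all add: form_add_left)
  moreover have "act xs v 0 = v 0 - form (weight_shift xs) ?u"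
    by (rule Cons.IH)
  moreover have "reflection i ?u 0 = ?u 0 - (if i = 0 then pair 0 (reflection 0 ?u) else 0)"
    using i by (cases "i = 0") (simp_all add: reflection_apply pair_reflection cox_def simple_root_def)
  ultimately show ?case
    by (simp add: act_simps)
qed

lemma act_outside:
  assumes "xs \<in> lists {..8}" "8 < k"
  shows "act xs v k = v k"
  using assms by (induction xs) (auto simp: act_simps reflection_apply simple_root_def)

text \<open>Coordinate 0 is, up to sign, the pairing with \<Lambda>. A shift of \<Lambda> in the
  radical leaves this coordinate unchanged under w, while a multiple of the null root shows up in it
  with factor 6; hence each \<open>n j\<close> is 0.\<close>

lemma weq_Nil_if_trivial_modulo_null_root:
  assumes xs: "xs \<in> lists {..8}"
    and shift: "\<And>k. k \<le> 8 \<Longrightarrow> weight_shift xs k = m * null_root k"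
    and roots: "\<And>j k. j \<le> 8 \<Longrightarrow> k \<le> 8 \<Longrightarrow> act xs (simple_root j) k = simple_root j k + n j * null_root k"
  shows "weq xs []"
proof (rule act_faithful[OF xs])
  fix j :: nat assume j: "j \<le> 8"
  have "act xs (simple_root j) 0 = simple_root j 0"
    using act_weight_shift[OF xs, of "simple_root j"] form_null_root[OF shift] by simp
  then have "n j = 0"
    using roots[OF j, of 0] by (simp add: null_root_def)
  show "act xs (simple_root j) = simple_root j"
  proof
    show "act xs (simple_root j) k = simple_root j k" for k
      using roots[OF j, of k] \<open>n j = 0\<close> act_outside[OF xs, of k] by (cases "k \<le> 8") simp_all
  qed
qed

section \<open>Existence and uniqueness of the transformations\<close>

context ring_morphism
begin

lemma beta_commute: "f (\<beta> \<alpha> n) = \<beta> (f \<circ> \<alpha>) n"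
  by (simp add: \<beta>_def \<rho>_def sum prod)

lemma ham_commute: "f (ham \<alpha> q p) = ham (f \<circ> \<alpha>) (f q) (f p)"
  unfolding ham_def coeff_defs \<kappa>_def \<epsilon>_def \<gamma>1_def \<gamma>2_def
  by (simp only: hom_simps beta_commute o_apply)

end

lemma ham_param_cong: "(\<And>j. j \<le> 8 \<Longrightarrow> \<alpha> j = \<alpha>' j) \<Longrightarrow> ham \<alpha> q p = ham \<alpha>' q p"
proof -
  assume eq: "\<And>j. j \<le> 8 \<Longrightarrow> \<alpha> j = \<alpha>' j"
  then have "\<beta> \<alpha> n = \<beta> \<alpha>' n" for n
    unfolding \<beta>_def \<rho>_def by (intro sum.cong prod.cong HOL.refl) auto
  then show ?thesis
    by (intro ham_cong) (simp_all add: \<kappa>_def \<epsilon>_def \<gamma>1_def \<gamma>2_def eq)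
qed

definition q_image :: "nat \<Rightarrow> ratfun" where
  "q_image i = (if i = 0 then X Vq + par 0 / X Vp else X Vq)"

definition p_image :: "nat \<Rightarrow> ratfun" where
  "p_image i = (if i = 1 then X Vp - par 1 / X Vq else if i = 6 then X Vp - par 6 / (X Vq - 1) else X Vp)"

definition acts :: "nat \<Rightarrow> (ratfun \<Rightarrow> ratfun) \<Rightarrow> bool" where
  "acts i w \<longleftrightarrow> automorphism w \<and> w (X Vq) = q_image i \<and> w (X Vp) = p_image i \<and> w (X Vt) = X Vt \<and>
     (\<forall>j\<le>8. w (par j) = reflected i par j)"

lemma all_le_8:
  "(\<forall>j\<le>8::nat. P j) \<longleftrightarrow> P 0 \<and> P 1 \<and> P 2 \<and> P 3 \<and> P 4 \<and> P 5 \<and> P 6 \<and> P 7 \<and> P 8"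
  unfolding le_8_cases by blast

lemma acts_as_listed_iff: "i \<le> 8 \<Longrightarrow> acts_as_listed i w \<longleftrightarrow> acts i w"
  unfolding le_8_cases
  by (elim disjE; hypsubst)
    (simp_all add: acts_as_listed_def acts_def all_le_8 tuple_def images_def q_image_def p_image_def
      reflected_eval del: One_nat_def)

lemma X_conv_par:
  "X Va0 = par 0" "X Va1 = par 1" "X Va2 = par 2" "X Va3 = par 3" "X Va4 = par 4"
  "X Va6 = par 6" "X Va7 = par 7" "X Va8 = par 8"
  by (simp_all add: par_def)

lemma automorphism_eqI_par:
  assumes "automorphism f" "automorphism g" "f (X Vq) = g (X Vq)" "f (X Vp) = g (X Vp)"
    "f (X Vt) = g (X Vt)" "\<And>j. j \<le> 8 \<Longrightarrow> f (par j) = g (par j)"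
  shows "f = g"
proof (rule automorphism_eqI[OF assms(1,2)])
  show "f (X v) = g (X v)" for v
    using assms by (cases v) (simp_all add: X_conv_par)
qed

lemma acts_unique: "acts i w \<Longrightarrow> acts i w' \<Longrightarrow> w = w'"
  by (rule automorphism_eqI_par) (simp_all add: acts_def)

text \<open>The parameters as polynomials, to serve as the numerators that
  \<open>substitution_involution\<close> asks for.\<close>

definition ppar :: "nat \<Rightarrow> mpoly" where
  "ppar j = [pvar Va0, pvar Va1, pvar Va2, pvar Va3, pvar Va4,
     - (6 * pvar Va0 + 5 * pvar Va1 + 4 * pvar Va2 + 3 * pvar Va3 + 2 * pvar Va4
        + 4 * pvar Va6 + 2 * pvar Va7 + 3 * pvar Va8),
     pvar Va6, pvar Va7, pvar Va8] ! j"

lemma emb_ppar: "j \<le> 8 \<Longrightarrow> emb (ppar j) = par j"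
  unfolding le_8_cases
  by (elim disjE) (simp_all add: ppar_def par_def emb.hom_simps X_conv_emb)

text \<open>\<open>par 5\<close> is not a variable but a linear form in the others. That it is sent
  to its listed image is exactly the invariance of the linear relation.\<close>

lemma reflected_relation:
  assumes "i \<le> 8"
  shows "reflected i par 5 = - (6 * reflected i par 0 + 5 * reflected i par 1 + 4 * reflected i par 2
    + 3 * reflected i par 3 + 2 * reflected i par 4
    + 4 * reflected i par 6 + 2 * reflected i par 7 + 3 * reflected i par 8)"
proof -
  have par_5: "par 5 = - (6 * par 0 + 5 * par 1 + 4 * par 2 + 3 * par 3 + 2 * par 4
      + 4 * par 6 + 2 * par 7 + 3 * par 8)"
    by (simp add: par_def)
  show ?thesis
    using assms unfolding le_8_cases
    by (elim disjE; hypsubst; simp only: reflected_eval par_5; simp add: algebra_simps)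
qed

fun var_image :: "nat \<Rightarrow> var \<Rightarrow> ratfun" where
  "var_image i Vq = q_image i" | "var_image i Vp = p_image i" | "var_image i Vt = X Vt"
| "var_image i Va0 = reflected i par 0" | "var_image i Va1 = reflected i par 1"
| "var_image i Va2 = reflected i par 2" | "var_image i Va3 = reflected i par 3"
| "var_image i Va4 = reflected i par 4" | "var_image i Va6 = reflected i par 6"
| "var_image i Va7 = reflected i par 7" | "var_image i Va8 = reflected i par 8"

lemma X_nonzero [simp]: "X v \<noteq> 0"
  using partial_X[of v v] partial.zero[of v] by auto

lemma X_neq_1 [simp]: "X v \<noteq> 1"
  using partial_X[of v v] partial.one[of v] by auto

lemma reflected_reflected: "reflected i \<alpha> j + of_int (cox i j) * reflected i \<alpha> i = \<alpha> j"
  by (simp add: reflected_def cox_def[of i i] algebra_simps)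

lemma ex_acts:
  assumes i: "i \<le> 8"
  obtains w where "acts i w" "w \<circ> w = id"
proof -
  let ?e = "meval const (var_image i)"
  note e_simps = ring_morphism_meval[OF const.ring_morphism_axioms, of "var_image i"]
  interpret e: ring_morphism ?e by (rule e_simps)
  have e_ppar: "?e (ppar j) = reflected i par j" if "j \<le> 8" for j
    using that reflected_relation[OF i] unfolding le_8_cases
    by (elim disjE) (simp_all add: ppar_def e.hom_simps e_simps del: One_nat_def)
  have "\<exists>d. d \<noteq> 0 \<and> ?e d = emb d \<and>
      (\<forall>v. \<exists>M k. var_image i v * emb d ^ k = emb M \<and> ?e M = X v * emb d ^ k)"
  proof -
    \<comment> \<open>The only denominator of the substitution: p, q or q - 1. It is fixed because
      node 0 moves only q, and nodes 1 and 6 move only p.\<close>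
    define d where "d = (if i = 0 then pvar Vp else if i = 1 then pvar Vq
      else if i = 6 then pvar Vq - 1 else 1)"
    have emb_d: "emb d = (if i = 0 then X Vp else if i = 1 then X Vq else if i = 6 then X Vq - 1 else 1)"
      by (simp add: d_def X_conv_emb emb.hom_simps)
    have "d \<noteq> 0"
      using emb_d emb_eq_0_iff[of d] by (simp split: if_splits)
    moreover have "?e d = emb d"
      unfolding emb_d d_def if_distrib[of ?e] e.hom_simps e_simps
      by (simp add: q_image_def p_image_def X_conv_emb emb.hom_simps)
    moreover have "\<exists>M k. var_image i v * emb d ^ k = emb M \<and> ?e M = X v * emb d ^ k" for v
    proof -
      have par_case: ?thesis if "X v = par j" "var_image i v = reflected i par j" "j \<le> 8" for j
      proof (intro exI conjI)
        show "var_image i v * emb d ^ 0 = emb (ppar j + of_int (cox i j) * ppar i)"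
          using that i by (simp add: emb.hom_simps emb_ppar) (simp add: reflected_def)
        show "?e (ppar j + of_int (cox i j) * ppar i) = X v * emb d ^ 0"
          using that i by (simp add: e.hom_simps e_ppar reflected_reflected)
      qed
      have q_case: ?thesis if "v = Vq"
      proof (cases "i = 0")
        case True
        show ?thesis
        proof (intro exI conjI)
          \<comment> \<open>The numerator is u + \<open>\<alpha> 0\<close> with u = q p; as u goes
            to u + \<open>\<alpha> 0\<close> and \<open>\<alpha> 0\<close> to its negative, the
            substitution returns it to u.\<close>
          show "var_image i v * emb d ^ 1 = emb (pvar Vq * pvar Vp + ppar 0)"
            using that True by (simp add: emb.hom_simps emb_ppar q_image_def emb_d X_conv_emb[symmetric] field_simps)
          show "?e (pvar Vq * pvar Vp + ppar 0) = X v * emb d ^ 1"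
            unfolding e.hom_simps e_simps e_ppar[of 0, simplified]
            using that True by (simp add: q_image_def p_image_def emb_d reflected_eval field_simps)
        qed
      next
        case False
        show ?thesis
          by (rule exI[of _ "pvar Vq"], rule exI[of _ 0])
            (use that False in \<open>simp add: e_simps q_image_def X_conv_emb\<close>)
      qed
      have p_case: ?thesis if "v = Vp"
      proof -
        consider "i = 1" | "i = 6" | "i \<noteq> 1" "i \<noteq> 6" by blast
        then show ?thesis
        proof cases
          case 1
          show ?thesis
          proof (intro exI conjI)
            show "var_image i v * emb d ^ 1 = emb (pvar Vp * pvar Vq - ppar 1)"
              using that 1 by (simp add: emb.hom_simps emb_ppar p_image_def emb_d X_conv_emb[symmetric] field_simps)
            show "?e (pvar Vp * pvar Vq - ppar 1) = X v * emb d ^ 1"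
              unfolding e.hom_simps e_simps e_ppar[of 1, OF one_le_numeral]
              using that 1
              by (simp add: q_image_def p_image_def emb_d reflected_eval field_simps del: One_nat_def)
          qed
        next
          case 2
          show ?thesis
          proof (intro exI conjI)
            show "var_image i v * emb d ^ 1 = emb (pvar Vp * (pvar Vq - 1) - ppar 6)"
              using that 2 by (simp add: emb.hom_simps emb_ppar p_image_def emb_d X_conv_emb[symmetric])
                (simp add: field_simps)
            show "?e (pvar Vp * (pvar Vq - 1) - ppar 6) = X v * emb d ^ 1"
              unfolding e.hom_simps e_simps e_ppar[of 6, simplified]
              using that 2 by (simp add: q_image_def p_image_def emb_d reflected_eval field_simps)
          qed
        next
          case 3
          show ?thesis
            by (rule exI[of _ "pvar Vp"], rule exI[of _ 0])
              (use that 3 in \<open>simp add: e_simps p_image_def X_conv_emb\<close>)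
        qed
      qed
      have t_case: ?thesis if "v = Vt"
        by (rule exI[of _ "pvar Vt"], rule exI[of _ 0]) (simp add: that e_simps X_conv_emb)
      show ?thesis
        by (cases v) (use q_case p_case t_case par_case X_conv_par in \<open>auto simp del: One_nat_def\<close>)
    qed
    ultimately show ?thesis by blast
  qed
  then obtain w where w: "automorphism w" "w \<circ> w = id" "\<And>v. w (X v) = var_image i v"
    using substitution_involution[of _ "var_image i"] by metis
  interpret w: field_morphism w by (rule automorphism_imp_field_morphism[OF w(1)])
  have "w (par j) = reflected i par j" if "j \<le> 8" for j
    using that reflected_relation[OF i] unfolding le_8_cases
    by (elim disjE) (simp_all add: par_def w.hom_simps w del: One_nat_def)
  then have "acts i w"
    by (simp add: acts_def w)
  then show thesis using that w(2) by blast
qed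

lemma ex1_acts_as_listed: "i \<le> 8 \<Longrightarrow> \<exists>!w. acts_as_listed i w"
  using acts_as_listed_iff ex_acts acts_unique by metis

lemma
  assumes "i \<le> 8"
  shows acts_s: "acts i (s i)" and s_comp_s: "s i \<circ> s i = id"
proof -
  show 1: "acts i (s i)"
    using theI'[OF ex1_acts_as_listed[OF assms]] acts_as_listed_iff[OF assms] by (simp add: s_def)
  obtain w where "acts i w" "w \<circ> w = id" using ex_acts[OF assms] .
  then show "s i \<circ> s i = id" using acts_unique[OF 1] by blast
qed

lemma s_simps:
  assumes "i \<le> 8"
  shows "s i (X Vq) = q_image i" "s i (X Vp) = p_image i" "s i (X Vt) = X Vt"
    and "j \<le> 8 \<Longrightarrow> s i (par j) = reflected i par j"
    and automorphism_s: "automorphism (s i)"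
  using acts_s[OF assms] by (simp_all add: acts_def)

lemma field_morphism_s: "i \<le> 8 \<Longrightarrow> field_morphism (s i)"
  by (intro automorphism_imp_field_morphism automorphism_s)

lemma s_hom:
  assumes "i \<le> 8"
  shows "s i (x + y) = s i x + s i y" "s i (x - y) = s i x - s i y" "s i (- x) = - s i x"
    "s i (x * y) = s i x * s i y" "s i (x / y) = s i x / s i y" "s i 1 = 1" "s i 0 = 0"
    "s i (of_int n) = of_int n" "s i x = 0 \<longleftrightarrow> x = 0"
proof -
  interpret field_morphism "s i" by (rule field_morphism_s[OF assms])
  show "s i (x + y) = s i x + s i y" "s i (x - y) = s i x - s i y" "s i (- x) = - s i x"
    "s i (x * y) = s i x * s i y" "s i (x / y) = s i x / s i y" "s i 1 = 1" "s i 0 = 0"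
    "s i (of_int n) = of_int n" "s i x = 0 \<longleftrightarrow> x = 0"
    by (rule field_hom_simps eq_0_iff)+
qed

section \<open>The relations\<close>

definition lin :: "(nat \<Rightarrow> int) \<Rightarrow> ratfun" where
  "lin v = (\<Sum>k\<le>8. of_int (v k) * par k)"

lemma lin_add: "lin (\<lambda>k. u k + v k) = lin u + lin v"
  by (simp add: lin_def ring_distribs sum.distrib)

lemma lin_root:
  assumes "j \<le> 8"
  shows "lin (\<lambda>k. c * simple_root j k) = of_int c * par j"
proof -
  have "lin (\<lambda>k. c * simple_root j k) = (\<Sum>k\<le>8. if k = j then of_int c * par j else 0)"
    unfolding lin_def by (rule sum.cong) (auto simp: simple_root_def)
  with assms show ?thesis by simp
qed

lemma lin_simple_root: "j \<le> 8 \<Longrightarrow> lin (simple_root j) = par j"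
  using lin_root[of j 1] by simp

lemma s_lin:
  assumes i: "i \<le> 8"
  shows "s i (lin v) = lin (reflection i v)"
proof -
  interpret s: field_morphism "s i" by (rule field_morphism_s[OF i])
  have "s i (lin v) = (\<Sum>k\<le>8. of_int (v k) * reflected i par k)"
    unfolding lin_def s.sum by (rule sum.cong) (simp_all add: s.hom_simps s_simps i)
  also have "\<dots> = lin v + (\<Sum>k\<le>8. of_int (cox i k * v k)) * par i"
    by (simp add: lin_def reflected_def ring_distribs sum.distrib sum_distrib_left sum_distrib_right ac_simps)
  also have "(\<Sum>k\<le>8. of_int (cox i k * v k)) = (of_int (pair i v) :: ratfun)"
    by (simp add: pair_def)
  also have "lin v + of_int (pair i v) * par i = lin (reflection i v)"
    unfolding reflection_def lin_add lin_root[OF i] ..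
  finally show ?thesis .
qed

lemma automorphism_comp: "automorphism f \<Longrightarrow> automorphism g \<Longrightarrow> automorphism (f \<circ> g)"
  by (auto simp: automorphism_def intro: bij_comp)

text \<open>Only node 0 moves q and only nodes 1 and 6 move p. Node 0 is joined to both of these,
  and 1 and 6 commute because each shifts p by a function of q and its own parameter.\<close>

lemma s_commute:
  assumes i: "i \<le> 8" and j: "j \<le> 8" and "i \<noteq> j" "{i, j} \<notin> E8_edges"
  shows "s i \<circ> s j = s j \<circ> s i"
proof (rule automorphism_eqI_par)
  have cox: "cox i j = 0" "cox j i = 0"
    using assms by (simp_all add: cox_nonedge cox_sym[of j i])
  have "{0, 1} \<in> E8_edges" "{0, 6} \<in> E8_edges" "{1, 0} \<in> E8_edges" "{6, 0} \<in> E8_edges"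
    by (simp_all add: E8_edges_def doubleton_eq_iff)
  then have ne: "i = 0 \<Longrightarrow> j \<noteq> 1 \<and> j \<noteq> 6" "j = 0 \<Longrightarrow> i \<noteq> 1 \<and> i \<noteq> 6"
    using assms(4) by metis+
  have fixed: "reflected i par j = par j" "reflected j par i = par i"
    using cox by (simp_all add: reflected_def)
  show "(s i \<circ> s j) (X Vq) = (s j \<circ> s i) (X Vq)"
    using i j fixed ne \<open>i \<noteq> j\<close>
    by (cases "i = 0"; cases "j = 0") (simp_all add: s_simps s_hom q_image_def p_image_def)
  consider "i \<noteq> 1" "i \<noteq> 6" "j \<noteq> 1" "j \<noteq> 6" | "i = 1" "j \<noteq> 0" "j \<noteq> 1" "j \<noteq> 6"
    | "i = 6" "j \<noteq> 0" "j \<noteq> 1" "j \<noteq> 6" | "j = 1" "i \<noteq> 0" "i \<noteq> 1" "i \<noteq> 6"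
    | "j = 6" "i \<noteq> 0" "i \<noteq> 1" "i \<noteq> 6" | "i = 1" "j = 6" | "i = 6" "j = 1"
    using ne \<open>i \<noteq> j\<close> by metis
  then show "(s i \<circ> s j) (X Vp) = (s j \<circ> s i) (X Vp)"
    by cases (use i j fixed in \<open>simp_all add: s_simps s_hom q_image_def p_image_def\<close>)
  show "(s i \<circ> s j) (X Vt) = (s j \<circ> s i) (X Vt)"
    using i j by (simp add: s_simps)
  show "(s i \<circ> s j) (par k) = (s j \<circ> s i) (par k)" if "k \<le> 8" for k
    using i j that fun_cong[OF reflection_commute[OF i j cox(1)], of "simple_root k"]
    by (simp add: s_lin flip: lin_simple_root)
qed (use i j in \<open>auto intro!: automorphism_comp automorphism_s\<close>)

text \<open>The braid relation of node 0 with node 1 (\<open>c = 0\<close>) or node 6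
  (\<open>c = 1\<close>), evaluated at q. In terms of r = q - c both cases are one identity.\<close>

lemma braid_fraction_q:
  fixes p q a b c :: "'a::field"
  assumes "p \<noteq> 0" "q - c \<noteq> 0" "p - b / (q - c) \<noteq> 0" "q + a / p - c \<noteq> 0"
  shows "q + a / p + b / (p - (b + a) / (q + a / p - c)) = q + (a + b) / (p - b / (q - c))"
proof -
  define r where "r = q - c"
  have r: "r \<noteq> 0" and rb: "r * p - b \<noteq> 0" and ra: "r * p + a \<noteq> 0"
    using assms by (auto simp: r_def field_simps)
  have R: "q + a / p - c = (r * p + a) / p"
    using assms(1) by (simp add: r_def field_simps)
  have "p - (b + a) / (q + a / p - c) = p * (r * p - b) / (r * p + a)"
    unfolding R using assms(1) ra by (simp add: field_simps)
  moreover have "p - b / (q - c) = (r * p - b) / r"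
    using r by (simp add: r_def field_simps)
  ultimately have "b / (p - (b + a) / (q + a / p - c)) = b * (r * p + a) / (p * (r * p - b))"
    "(a + b) / (p - b / (q - c)) = (a + b) * r / (r * p - b)"
    by simp_all
  moreover have "a / p + b * (r * p + a) / (p * (r * p - b)) = (a + b) * r / (r * p - b)"
    using assms(1) rb by (simp add: field_simps)
  ultimately show ?thesis by (simp add: add.assoc)
qed

lemma braid_fraction_p:
  fixes p q a b c :: "'a::field"
  assumes "p \<noteq> 0" "q - c \<noteq> 0" "p - b / (q - c) \<noteq> 0" "q + a / p - c \<noteq> 0"
  shows "p - b / (q - c) - a / (q + (a + b) / (p - b / (q - c)) - c) = p - (b + a) / (q + a / p - c)"
proof -
  define r where "r = q - c"
  have r: "r \<noteq> 0" and rb: "r * p - b \<noteq> 0" and ra: "r * p + a \<noteq> 0"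
    using assms by (auto simp: r_def field_simps)
  have R: "q + a / p - c = (r * p + a) / p"
    using assms(1) by (simp add: r_def field_simps)
  have 1: "p - (b + a) / (q + a / p - c) = p * (r * p - b) / (r * p + a)"
    unfolding R using assms(1) ra by (simp add: field_simps)
  have 2: "p - b / (q - c) = (r * p - b) / r"
    using r by (simp add: r_def field_simps)
  have "q + (a + b) / (p - b / (q - c)) - c = r + (a + b) * r / (r * p - b)"
    unfolding 2 by (simp add: r_def)
  also have "\<dots> = r * (r * p + a) / (r * p - b)"
    using rb by (simp add: field_simps)
  finally have 3: "a / (q + (a + b) / (p - b / (q - c)) - c) = a * (r * p - b) / (r * (r * p + a))"
    by simp
  have "m / r - a * m / (r * D) = p * m / D" if "a = D - r * p" "D \<noteq> 0" for m D
    unfolding that(1) using that(2) r by (simp add: field_simps)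
  from this[of "r * p + a" "r * p - b"] show ?thesis
    unfolding 3 unfolding 1 2 using ra by simp
qed

lemma s_braid_par:
  assumes i: "i \<le> 8" and j: "j \<le> 8" and "{i, j} \<in> E8_edges" and "k \<le> 8"
  shows "(s i \<circ> s j \<circ> s i) (par k) = (s j \<circ> s i \<circ> s j) (par k)"
  using i j assms(4) fun_cong[OF reflection_braid[OF i j cox_edge[OF assms(3)]], of "simple_root k"]
  by (simp add: s_lin flip: lin_simple_root)

lemma s_braid:
  assumes i: "i \<le> 8" and j: "j \<le> 8" and edge: "{i, j} \<in> E8_edges"
  shows "s i \<circ> s j \<circ> s i = s j \<circ> s i \<circ> s j"
proof -
  have "(s i \<circ> s j \<circ> s i) (X v) = (s j \<circ> s i \<circ> s j) (X v)"
    if "(i, j) \<in> {(0, 1), (1, 2), (2, 3), (3, 4), (4, 5), (0, 6), (6, 7), (0, 8)}" "v \<in> {Vq, Vp}" for i j v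
  proof -
    \<comment> \<open>Each of these is the image of a nonzero element under an injective
      map.\<close>
    have nz: "X Vp - par 1 / X Vq \<noteq> 0" "X Vq + par 0 / X Vp \<noteq> 0"
      "X Vp - par 6 / (X Vq - 1) \<noteq> 0" "X Vq + par 0 / X Vp - 1 \<noteq> 0"
      using s_hom(9)[of 1 "X Vp"] s_hom(9)[of 0 "X Vq"] s_hom(9)[of 6 "X Vp"] s_hom(9)[of 0 "X Vq - 1"]
      by (simp_all add: s_simps s_hom q_image_def p_image_def del: One_nat_def)
    note braid_q = braid_fraction_q[of "X Vp" "X Vq" 0 "par 1" "par 0"]
      braid_fraction_q[of "X Vp" "X Vq" 1 "par 6" "par 0"]
    note braid_p = braid_fraction_p[of "X Vp" "X Vq" 0 "par 1" "par 0"]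
      braid_fraction_p[of "X Vp" "X Vq" 1 "par 6" "par 0"]
    from that show ?thesis using braid_q braid_p nz
      by (elim insertE emptyE Pair_inject; hypsubst)
        (simp_all add: s_simps s_hom q_image_def p_image_def reflected_eval add_divide_distrib
          del: One_nat_def)
  qed
  moreover have "(i, j) \<in> {(0, 1), (1, 2), (2, 3), (3, 4), (4, 5), (0, 6), (6, 7), (0, 8)} \<or>
      (j, i) \<in> {(0, 1), (1, 2), (2, 3), (3, 4), (4, 5), (0, 6), (6, 7), (0, 8)}"
    using edge unfolding E8_edges_def by (auto simp: doubleton_eq_iff)
  ultimately have qp: "(s i \<circ> s j \<circ> s i) (X v) = (s j \<circ> s i \<circ> s j) (X v)" if "v \<in> {Vq, Vp}" for v
    using that by metis
  show ?thesis
  proof (rule automorphism_eqI_par)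
    show "(s i \<circ> s j \<circ> s i) (X Vt) = (s j \<circ> s i \<circ> s j) (X Vt)"
      using i j by (simp add: s_simps)
  qed (use i j edge qp s_braid_par in \<open>auto intro!: automorphism_comp automorphism_s simp del: o_apply\<close>)
qed

lemma s_order_2: "i \<le> 8 \<Longrightarrow> j \<le> 8 \<Longrightarrow> i \<noteq> j \<Longrightarrow> {i, j} \<notin> E8_edges \<Longrightarrow> (s i \<circ> s j) ^^ 2 = id"
  by (intro commute_imp_order_2 s_comp_s s_commute)

lemma s_order_3: "i \<le> 8 \<Longrightarrow> j \<le> 8 \<Longrightarrow> {i, j} \<in> E8_edges \<Longrightarrow> (s i \<circ> s j) ^^ 3 = id"
  by (intro braid_imp_order_3 s_comp_s s_braid)

section \<open>The Baecklund property\<close>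

lemma partial_reflected:
  "u \<in> {Vq, Vp, Vt} \<Longrightarrow> i \<le> 8 \<Longrightarrow> j \<le> 8 \<Longrightarrow> partial u (reflected i par j) = 0"
  by (simp add: reflected_def partial.derivation_simps partial_par)

context ratfun_derivation
begin

lemma power_eq_0: "d f = 0 \<Longrightarrow> d (f ^ n) = 0"
  by (induction n) (simp_all add: one mult)

lemma coefficients_eq_0:
  assumes \<alpha>: "\<And>j. j \<le> 8 \<Longrightarrow> d (\<alpha> j) = 0" and u: "d u = 0"
  shows "d (F1 \<alpha> u) = 0" "d (K2 \<alpha> u) = 0"
proof -
  have "d (\<rho> \<alpha> n) = 0" if "n \<in> {1, 2, 3, 4, 5}" for n
    using that by (elim insertE emptyE; hypsubst)
      (simp_all add: rho_explicit add \<alpha> del: One_nat_def)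
  then have "d (\<beta> \<alpha> n) = 0" if "n \<in> {1, 2, 3, 4, 5}" for n
    using that by (elim insertE emptyE; hypsubst)
      (simp_all add: beta_explicit add mult del: One_nat_def)
  moreover have "d (\<kappa> \<alpha>) = 0" "d (\<epsilon> \<alpha>) = 0" "d (\<gamma>1 \<alpha>) = 0" "d (\<gamma>2 \<alpha>) = 0"
    by (simp_all add: \<kappa>_def \<epsilon>_def \<gamma>1_def \<gamma>2_def derivation_simps \<alpha>)
  ultimately show "d (F1 \<alpha> u) = 0" "d (K2 \<alpha> u) = 0"
    using u unfolding coeff_defs
    by (simp_all add: derivation_simps power_eq_0 del: One_nat_def)
qed

end

text \<open>The constant \<open>C\<close> is a value of \<open>F1\<close> for nodes 0 and 1 and a
  difference of values of \<open>K2\<close> for node 6; the arguments are free of q and p, so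
  \<open>C\<close> is too.\<close>

lemma s_I:
  assumes i: "i \<le> 8"
  obtains C where "s i I = I + C" "partial Vq C = 0" "partial Vp C = 0"
proof -
  interpret s: field_morphism "s i" by (rule field_morphism_s[OF i])
  have "s i I = ham (s i \<circ> par) (q_image i) (p_image i)"
    unfolding I_def s.ham_commute using i by (simp add: s_simps)
  also have "\<dots> = ham (reflected i par) (q_image i) (p_image i)"
    using i by (intro ham_param_cong) (simp add: s_simps)
  finally have sI: "s i I = ham (reflected i par) (q_image i) (p_image i)" .
  have rel: "\<beta> par 1 = - 3 * \<kappa> par - 2 * \<gamma>1 par"
    by (rule beta_1_relation[OF par_relation])
  have nz: "X Vq + par 0 / X Vp \<noteq> 0"
    using s_hom(9)[of 0 "X Vq"] by (simp add: s_simps q_image_def)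
  have const: "partial u (F1 (reflected i par) c) = 0" "partial u (K2 (reflected i par) c) = 0"
    "partial u (K2 par c) = 0" if "u \<in> {Vq, Vp}" "partial u c = 0" for u c
    using that i by (auto intro!: partial.coefficients_eq_0 partial_reflected partial_par)
  consider "i = 0" | "i = 1" | "i = 6" | "i \<in> {2, 3, 4, 5, 7, 8}"
    using i unfolding le_8_cases by blast
  then show thesis
  proof cases
    case 1
    then have "s i I = I + F1 (reflected i par) (par 0)"
      unfolding sI unfolding I_def
      using ham_reflected_0[OF rel _ _ nz] by (simp add: q_image_def p_image_def)
    then show thesis by (rule that) (auto intro!: const partial_par)
  next
    case 2
    then have "s i I = I + F1 (reflected i par) (- par 1)"
      unfolding sI unfolding I_def
      using ham_reflected_1[OF rel] by (simp add: q_image_def p_image_def del: One_nat_def)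
    then show thesis
      by (rule that) (auto intro!: const simp: partial.uminus partial_par simp del: One_nat_def)
  next
    case 3
    then have "s i I = I + (K2 (reflected i par) (- par 6) - K2 par 0)"
      unfolding sI unfolding I_def
      using ham_reflected_6[OF rel] by (simp add: q_image_def p_image_def)
    then show thesis
      by (rule that) (simp_all add: partial.diff const partial.uminus partial_par partial.zero)
  next
    case 4
    then have "s i I = I + 0"
      unfolding sI unfolding I_def
      using ham_reflected_neutral[OF 4, of par] 4 by (auto simp: q_image_def p_image_def)
    then show thesis by (rule that) (simp_all add: partial.zero)
  qed
qed

lemma ddt_s:
  assumes i: "i \<le> 8"
  shows "ddt (s i f) = s i (ddt f)"
proof (rule ddt_canonical[OF automorphism_s[OF i]])
  show "s i (X Vt) = X Vt" using i by (simp add: s_simps)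
  show "partial u (s i (X v)) = 0" if "u \<in> {Vq, Vp, Vt}" "v \<notin> {Vq, Vp, Vt}" for u v
    using that i by (cases v) (auto simp: X_conv_par s_simps partial_reflected simp del: One_nat_def)
  show "partial Vt (s i (X Vq)) = 0" "partial Vt (s i (X Vp)) = 0"
    using i by (simp_all add: s_simps q_image_def p_image_def partial.derivation_simps partial_X partial_par)
  show "poisson (s i (X Vq)) (s i (X Vp)) = 1"
    using i by (simp add: poisson_def s_simps q_image_def p_image_def partial.derivation_simps partial_X partial_par)
  obtain C where "s i I = I + C" "partial Vq C = 0" "partial Vp C = 0" using s_I[OF i] .
  then show "partial Vq (s i I) = partial Vq I" "partial Vp (s i I) = partial Vp I"
    by (simp_all add: partial.add)
qed

lemma baecklund_s: "i \<le> 8 \<Longrightarrow> baecklund (s i)"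
  by (intro baecklund_if_commutes automorphism_s ddt_s)

section \<open>The group of transformations\<close>

lemma automorphism_id: "automorphism id"
  by (simp add: automorphism_def)

lemma group_Aut: "group Aut"
proof (rule groupI)
  show "\<one>\<^bsub>Aut\<^esub> \<in> carrier Aut"
    by (simp add: Aut_def automorphism_def)
  show "f \<otimes>\<^bsub>Aut\<^esub> g \<in> carrier Aut" if "f \<in> carrier Aut" "g \<in> carrier Aut" for f g
    using that by (simp add: Aut_def automorphism_comp)
  show "f \<otimes>\<^bsub>Aut\<^esub> g \<otimes>\<^bsub>Aut\<^esub> h = f \<otimes>\<^bsub>Aut\<^esub> (g \<otimes>\<^bsub>Aut\<^esub> h)" for f g h
    by (simp add: Aut_def comp_assoc)
  show "\<one>\<^bsub>Aut\<^esub> \<otimes>\<^bsub>Aut\<^esub> f = f" for f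
    by (simp add: Aut_def)
  show "\<exists>g\<in>carrier Aut. g \<otimes>\<^bsub>Aut\<^esub> f = \<one>\<^bsub>Aut\<^esub>" if "f \<in> carrier Aut" for f
  proof -
    have f: "automorphism f" using that by (simp add: Aut_def)
    interpret f: field_morphism f by (rule automorphism_imp_field_morphism[OF f])
    have bij: "bij f" using f by (simp add: automorphism_def)
    have f_inv: "f (inv_into UNIV f x) = x" and inv_f: "inv_into UNIV f (f x) = x" for x
      using bij by (simp_all add: bij_is_surj surj_f_inv_f bij_is_inj)
    have "automorphism (inv_into UNIV f)"
      unfolding automorphism_def
    proof (intro conjI allI)
      show "bij (inv_into UNIV f)" using bij by (rule bij_imp_bij_inv)
      show "inv_into UNIV f (const c) = const c" for c
        using f inv_f[of "const c"] by (simp add: automorphism_def)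
      show "inv_into UNIV f (x + y) = inv_into UNIV f x + inv_into UNIV f y" for x y
        using inv_f[of "inv_into UNIV f x + inv_into UNIV f y"] by (simp add: f.add f_inv)
      show "inv_into UNIV f (x * y) = inv_into UNIV f x * inv_into UNIV f y" for x y
        using inv_f[of "inv_into UNIV f x * inv_into UNIV f y"] by (simp add: f.mult f_inv)
    qed
    moreover have "inv_into UNIV f \<circ> f = id" using inv_f by (simp add: fun_eq_iff)
    ultimately show ?thesis by (auto simp: Aut_def)
  qed
qed

interpretation Aut: group Aut
  by (rule group_Aut)

lemma Aut_mult [simp]: "f \<otimes>\<^bsub>Aut\<^esub> g = f \<circ> g" and Aut_one [simp]: "\<one>\<^bsub>Aut\<^esub> = id"
  and Aut_carrier [simp]: "f \<in> carrier Aut \<longleftrightarrow> automorphism f"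
  by (simp_all add: Aut_def)

lemma inv_s:
  assumes "i \<le> 8"
  shows "inv\<^bsub>Aut\<^esub> (s i) = s i"
  by (rule Aut.inv_equality) (simp_all add: assms s_comp_s automorphism_s)

lemma baecklund_generated:
  assumes "w \<in> carrier (subgroup_generated Aut (s ` {..8}))"
  shows "baecklund w"
proof -
  have "w \<in> generate Aut (carrier Aut \<inter> s ` {..8})"
    using assms by (simp add: carrier_subgroup_generated)
  \<comment> \<open>The induction carries commutation with \<open>ddt\<close>, which passes to
    products directly; the generators are their own inverses.\<close>
  then have "automorphism w \<and> (\<forall>f. ddt (w f) = w (ddt f))"
  proof (induction rule: generate.induct)
    case one
    have "automorphism \<one>\<^bsub>Aut\<^esub>" "ddt (\<one>\<^bsub>Aut\<^esub> f) = \<one>\<^bsub>Aut\<^esub> (ddt f)" for f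
      using automorphism_id by simp_all
    then show ?case by blast
  next
    case (incl h)
    then show ?case by (auto simp: ddt_s)
  next
    case (inv h)
    then show ?case by (auto simp: ddt_s inv_s)
  next
    case (eng h1 h2)
    then show ?case using automorphism_comp[of h1 h2] by (simp add: o_def)
  qed
  then show ?thesis by (simp add: baecklund_if_commutes)
qed

section \<open>Faithfulness\<close>

text \<open>The parameters are replaced by \<open>\<alpha> z\<close> and everything is expanded at \<open>z = 0\<close>. Without the parameters
  every \<open>s\<^sub>i\<close> is the identity; the linear term of \<open>w q\<close> is the shift \<open>w \<Lambda> - \<Lambda>\<close> divided by \<open>p\<close>.\<close>

lemma deformation:
  obtains T where "field_morphism T" "T (X Vq) = fls_const (X Vq)" "T (X Vp) = fls_const (X Vp)"
    "\<And>v. T (lin v) = fps_to_fls (fps_X * fps_const (lin v))"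
proof -
  \<comment> \<open>At z = 0 the parameters are lost; injectivity is therefore checked at z = 1,
    where all variables reappear.\<close>
  let ?g = "\<lambda>v. if v \<in> {Vq, Vp, Vt} then [:X v:] else [:0, X v:]"
  obtain T where T: "field_morphism T" "\<And>c. T (const c) = fls_const (const c)"
    "\<And>v. T (X v) = fps_to_fls (fps_of_poly (?g v))"
    by (rule taylor_morphism[of ?g 1]) (auto split: if_splits)
  interpret T: field_morphism T by (rule T)
  interpret C: ring_morphism "fls_const :: ratfun \<Rightarrow> ratfun fls"
    by unfold_locales (simp_all add: fls_plus_const)
  have X: "T (X v) = fps_to_fls (fps_X * fps_const (X v))" if "v \<notin> {Vq, Vp, Vt}" for v
  proof -
    have "fps_of_poly [:0, X v:] = fps_X * fps_const (X v)"
      by (simp add: fps_eq_iff coeff_pCons fps_X_mult_nth split: nat.split)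
    then show ?thesis using that T(3)[of v] by simp
  qed
  have par: "T (par j) = fls_X * fls_const (par j)" if "j \<le> 8" for j
    using that unfolding le_8_cases
    by (elim disjE)
      (simp_all add: par_def T.hom_simps X fls_times_fps_to_fls C.hom_simps algebra_simps
        del: fls_const_mult_const)
  have "T (lin v) = fps_to_fls (fps_X * fps_const (lin v))" for v
  proof -
    have "T (lin v) = (\<Sum>k\<le>8. of_int (v k) * (fls_X * fls_const (par k)))"
      unfolding lin_def T.sum by (rule sum.cong) (simp_all add: T.hom_simps par)
    also have "\<dots> = fls_X * fls_const (lin v)"
      unfolding lin_def C.sum sum_distrib_left
      by (simp add: C.mult C.of_int mult.left_commute del: fls_const_mult_const)
    finally show ?thesis by (simp add: fls_times_fps_to_fls)
  qed
  moreover have "T (X Vq) = fls_const (X Vq)" "T (X Vp) = fls_const (X Vp)"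
    by (simp_all add: T fps_of_poly_const)
  ultimately show thesis using that T(1) by blast
qed

lemma lin_zero: "lin (\<lambda>_. 0) = 0"
  by (simp add: lin_def)

text \<open>The eight parameters other than \<open>par 5\<close> are independent, as partial
  derivatives show, and \<open>par 5\<close> contributes its coefficient times the linear relation.
  The multiple is \<open>v 5\<close> because the null root has coefficient 1 there.\<close>

lemma lin_eq_0_imp:
  assumes "lin v = 0" "k \<le> 8"
  shows "v k = v 5 * null_root k"
proof -
  have of_int: "(of_int n :: ratfun) = 0 \<longleftrightarrow> n = 0" for n
  proof -
    have "const (of_int n) = of_int n" by (rule const.of_int)
    then show ?thesis
      using emb_eq_0_iff[of "pconst (of_int n)"] by (auto simp: const_conv_emb single_zero)
  qed
  have "partial u (lin v) = 0" for u
    by (simp add: assms partial.zero)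
  then have "partial u (\<Sum>k\<le>8. of_int (v k) * par k) = 0" for u
    by (simp add: lin_def)
  note d = this[unfolded sum_atMost_8]
  have eqs: "of_int (v 0 - 6 * v 5) = (0::ratfun)" "of_int (v 1 - 5 * v 5) = (0::ratfun)"
    "of_int (v 2 - 4 * v 5) = (0::ratfun)" "of_int (v 3 - 3 * v 5) = (0::ratfun)"
    "of_int (v 4 - 2 * v 5) = (0::ratfun)" "of_int (v 6 - 4 * v 5) = (0::ratfun)"
    "of_int (v 7 - 2 * v 5) = (0::ratfun)" "of_int (v 8 - 3 * v 5) = (0::ratfun)"
    using d[of Va0] d[of Va1] d[of Va2] d[of Va3] d[of Va4] d[of Va6] d[of Va7] d[of Va8]
    by (simp_all add: par_def partial.derivation_simps partial_X algebra_simps del: One_nat_def)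
  from assms(2) eqs show ?thesis
    unfolding le_8_cases of_int by (elim disjE) (simp_all add: null_root_def del: One_nat_def)
qed

abbreviation field_act :: "nat list \<Rightarrow> ratfun \<Rightarrow> ratfun" where
  "field_act xs \<equiv> word_action s (pos xs)"

lemma field_act_simps:
  "field_act [] = id" "field_act (i # xs) = s i \<circ> field_act xs"
  "field_act (xs @ ys) = field_act xs \<circ> field_act ys"
  by (simp_all add: pos_def word_action_append)

lemma automorphism_field_act: "xs \<in> lists {..8} \<Longrightarrow> automorphism (field_act xs)"
proof (induction xs)
  case Nil
  show ?case unfolding field_act_simps by (rule automorphism_id)
next
  case (Cons i xs)
  then show ?case
    unfolding field_act_simps by (intro automorphism_comp automorphism_s) auto
qed

lemma field_act_lin: "xs \<in> lists {..8} \<Longrightarrow> field_act xs (lin v) = lin (act xs v)"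
proof (induction xs)
  case Nil
  show ?case by (simp add: field_act_simps act_simps)
next
  case (Cons i xs)
  then show ?case by (simp add: field_act_simps act_simps s_lin)
qed

lemma field_act_faithful:
  assumes xs: "xs \<in> lists {..8}" and id: "field_act xs = id"
  shows "weq xs []"
proof -
  obtain T where "field_morphism T" and T_q: "T (X Vq) = fls_const (X Vq)" and T_p: "T (X Vp) = fls_const (X Vp)"
    and T_lin: "\<And>v. T (lin v) = fps_to_fls (fps_X * fps_const (lin v))"
    by (rule deformation) blast
  interpret T: field_morphism T by fact
  have divide: "fps_to_fls A / fps_to_fls B = fps_to_fls (A * inverse B)" if "B $ 0 \<noteq> 0" for A B :: "ratfun fps"
    using that by (simp add: divide_inverse fls_inverse_fps_to_fls fls_times_fps_to_fls)
  \<comment> \<open>Appending a letter i means applying the old automorphism to the formula for the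
    i-th generator. Images of parameters start at order z, so a correction to q contributes at first
    order its linear coefficient divided by p; of the image of p only the constant term is
    needed.\<close>
  have "\<exists>F G. T (field_act xs (X Vq)) = fps_to_fls F \<and> F $ 0 = X Vq \<and> F $ 1 = lin (weight_shift xs) / X Vp \<and>
      T (field_act xs (X Vp)) = fps_to_fls G \<and> G $ 0 = X Vp"
    using xs
  proof (induction xs rule: rev_induct)
    case Nil
    show ?case
      by (intro exI[of _ "fps_const (X Vq)"] exI[of _ "fps_const (X Vp)"])
        (simp add: field_act_simps T_q T_p lin_zero)
  next
    case (snoc i xs)
    then have xs: "xs \<in> lists {..8}" and i: "i \<le> 8" by auto
    then obtain F G where F: "T (field_act xs (X Vq)) = fps_to_fls F" "F $ 0 = X Vq"
        "F $ 1 = lin (weight_shift xs) / X Vp"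
      and G: "T (field_act xs (X Vp)) = fps_to_fls G" "G $ 0 = X Vp"
      using snoc.IH by blast
    interpret w: field_morphism "field_act xs"
      by (rule automorphism_imp_field_morphism[OF automorphism_field_act[OF xs]])
    define A where "A j = fps_X * fps_const (lin (act xs (simple_root j)))" for j
    have T_par: "T (field_act xs (par j)) = fps_to_fls (A j)" if "j \<le> 8" for j
      using that field_act_lin[OF xs, of "simple_root j"] by (simp add: lin_simple_root T_lin A_def)
    have A: "A j $ 0 = 0" "A j $ 1 = lin (act xs (simple_root j))" for j
      by (simp_all add: A_def)
    let ?F = "if i = 0 then F + A 0 * inverse G else F"
    let ?G = "if i = 1 then G - A 1 * inverse F else if i = 6 then G - A 6 * inverse (F - 1) else G"
    have "T (field_act (xs @ [i]) (X Vq)) = fps_to_fls ?F"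
      using i F G by (simp add: field_act_simps s_simps q_image_def w.field_hom_simps T.field_hom_simps T_par divide)
    moreover have "T (field_act (xs @ [i]) (X Vp)) = fps_to_fls ?G"
    proof -
      have "fps_to_fls F - 1 = fps_to_fls (F - 1)" by simp
      then show ?thesis
        using i F G T_par[of 1]
        by (simp add: field_act_simps s_simps p_image_def w.field_hom_simps T.field_hom_simps T_par divide
            del: fps_to_fls_minus) simp
    qed
    moreover have "?F $ 0 = X Vq" "?G $ 0 = X Vp"
      using F G A by (simp_all del: One_nat_def)
    moreover have "?F $ 1 = lin (weight_shift (xs @ [i])) / X Vp"
      using F G A by (simp add: weight_shift_snoc lin_add lin_zero fps_mult_nth_1 ring_distribs divide_inverse
          del: One_nat_def)
    ultimately show ?case by blast
  qed
  then obtain F where F: "T (X Vq) = fps_to_fls F" "F $ 1 = lin (weight_shift xs) / X Vp"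
    by (auto simp: id)
  \<comment> \<open>For the identity the expansion of q has no linear term, so \<open>lin\<close>
    kills the shift of the weight, which is thus a multiple of the null root.\<close>
  then have "F = fps_const (X Vq)"
    using T_q by (simp flip: fps_const_to_fls)
  then have "lin (weight_shift xs) = 0"
    using F(2) by simp
  then have shift: "weight_shift xs k = weight_shift xs 5 * null_root k" if "k \<le> 8" for k
    using that by (rule lin_eq_0_imp)
  have "lin (\<lambda>k. act xs (simple_root j) k + (- simple_root j k)) = 0" for j
  proof -
    have "lin (act xs (simple_root j)) = lin (simple_root j)"
      using field_act_lin[OF xs, of "simple_root j"] id by simp
    moreover have "lin (\<lambda>k. - simple_root j k) = - lin (simple_root j)"
      by (simp add: lin_def sum_negf)
    ultimately show ?thesis unfolding lin_add by simp
  qed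
  note difference = lin_eq_0_imp[OF this]
  show ?thesis
  proof (rule weq_Nil_if_trivial_modulo_null_root[OF xs shift])
    show "act xs (simple_root j) k = simple_root j k +
        (act xs (simple_root j) 5 - simple_root j 5) * null_root k" if "k \<le> 8" for j k
      using difference[OF that, of j] by algebra
  qed
qed

lemma word_action_s_cong:
  "(u, v) \<in> word_rel {..8} E8_relators \<Longrightarrow> word_action s u = word_action s v"
  by (rule word_action_cong) (simp_all add: s_comp_s s_order_2 s_order_3)

lemma word_rel_pos:
  assumes "u \<in> words {..8}"
  shows "(u, pos (map fst u)) \<in> word_rel {..8} E8_relators"
  using assms
proof (induction u)
  case Nil
  show ?case by (auto simp: pos_def words_def intro!: word_rel.refl)
next
  case (Cons x u)
  obtain i b where x: "x = (i, b)" by (cases x)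
  have i: "i \<le> 8" and u: "u \<in> words {..8}" using Cons.prems by (auto simp: words_def x)
  have letter: "([(i, True)], [(i, True)]) \<in> word_rel {..8} E8_relators"
    "([(i, False)], [(i, False)]) \<in> word_rel {..8} E8_relators"
    using i by (auto simp: words_def intro!: word_rel.refl)
  \<comment> \<open>The word formed by an inverse letter and two copies of the letter reduces to the
    inverse letter by the square relation, and to the letter by cancellation.\<close>
  have "([(i, False)] @ [(i, True), (i, True)], [(i, False)] @ []) \<in> word_rel {..8} E8_relators"
    using weq_square[OF i] by (intro word_rel.append letter) (simp add: weq_def pos_def)
  moreover have "([(i, False), (i, True)] @ [(i, True)], [] @ [(i, True)]) \<in> word_rel {..8} E8_relators"
    using word_rel.cancel[of i "{..8}" False E8_relators] i by (intro word_rel.append letter) simp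
  ultimately have "([(i, False)], [(i, True)]) \<in> word_rel {..8} E8_relators"
    using word_rel.sym word_rel.trans by fastforce
  then have "([x], [(i, True)]) \<in> word_rel {..8} E8_relators"
    using letter by (cases b) (simp_all add: x)
  from word_rel.append[OF this Cons.IH[OF u]] show ?case
    by (simp add: pos_def x)
qed

text \<open>Once inverse letters are removed, reversing a list inverts it, so equality of two
  actions becomes triviality of one, to which \<open>field_act_faithful\<close> applies.\<close>

lemma word_action_s_inject:
  assumes u: "u \<in> words {..8}" and v: "v \<in> words {..8}" and eq: "word_action s u = word_action s v"
  shows "(u, v) \<in> word_rel {..8} E8_relators"
proof -
  let ?xs = "map fst u" and ?ys = "map fst v"
  have lists: "?xs \<in> lists {..8}" "?ys \<in> lists {..8}" "rev ?ys \<in> lists {..8}"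
    using u v by (auto simp: words_def in_lists_conv_set)
  have "field_act ?xs = field_act ?ys"
    using eq word_action_s_cong[OF word_rel_pos[OF u]] word_action_s_cong[OF word_rel_pos[OF v]] by simp
  then have "field_act (?xs @ rev ?ys) = field_act (?ys @ rev ?ys)"
    by (simp add: field_act_simps)
  also have "\<dots> = field_act []"
    using weq_palindrome[OF lists(2)] unfolding weq_def by (rule word_action_s_cong)
  finally have "weq (?xs @ rev ?ys) []"
    using lists by (intro field_act_faithful) (simp_all add: field_act_simps)
  then have "weq ?xs ?ys"
    using lists(1,2) by (rule weq_of_product)
  then show ?thesis
    using word_rel_pos[OF u] word_rel_pos[OF v] unfolding weq_def
    by (blast intro: word_rel.trans word_rel.sym)
qed

lemma word_action_s_generated:
  assumes "u \<in> words {..8}"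
  shows "word_action s u \<in> carrier (subgroup_generated Aut (s ` {..8}))"
  using assms
proof (induction u)
  case Nil
  show ?case
    unfolding word_action_simps carrier_subgroup_generated
    using generate.one[of Aut "carrier Aut \<inter> s ` {..8}"] unfolding Aut_one .
next
  case (Cons x u)
  then have x: "fst x \<le> 8" and u: "u \<in> words {..8}" by (auto simp: words_def)
  have "s (fst x) \<in> generate Aut (carrier Aut \<inter> s ` {..8})"
    using x by (intro generate.incl) (simp add: automorphism_s)
  from generate.eng[OF this Cons.IH[OF u, unfolded carrier_subgroup_generated]] show ?case
    unfolding word_action_simps carrier_subgroup_generated Aut_mult .
qed

lemma iso_W_E8:
  "\<exists>\<phi>\<in>iso W_E8 (subgroup_generated Aut (s ` {..8})). \<forall>i\<le>8. \<phi> (W_gen i) = s i"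
proof -
  have "\<exists>\<phi>\<in>iso (presented_group {..8} E8_relators) (subgroup_generated Aut (s ` {..8})).
      \<forall>i\<in>{..8}. \<phi> (word_rel {..8} E8_relators `` {[(i, True)]}) = s i"
  proof (rule iso_presented_group[OF E8_relators_subset group_Aut, where val = "word_action s"])
    show "s ` {..8} \<subseteq> carrier Aut" by (auto simp: automorphism_s)
    show "(u, v) \<in> word_rel {..8} E8_relators \<longleftrightarrow> word_action s u = word_action s v"
      if "u \<in> words {..8}" "v \<in> words {..8}" for u v
      using word_action_s_inject[OF that] word_action_s_cong by blast
  qed (simp_all add: word_action_append word_action_s_generated)
  then show ?thesis by (simp add: W_E8_def W_gen_def Ball_def)
qed

theorem theorem12p1:
  shows "(\<forall>i\<le>8. \<exists>!w. acts_as_listed i w) \<and>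
    (\<forall>i\<le>8. baecklund (s i)) \<and>
    (\<forall>i\<le>8. s i \<circ> s i = id) \<and>
    (\<forall>i\<le>8. \<forall>j\<le>8. {i, j} \<in> E8_edges \<longrightarrow> (s i \<circ> s j) ^^ 3 = id) \<and>
    (\<forall>i\<le>8. \<forall>j\<le>8. i \<noteq> j \<and> {i, j} \<notin> E8_edges \<longrightarrow> (s i \<circ> s j) ^^ 2 = id) \<and>
    (\<forall>w \<in> carrier (subgroup_generated Aut (s ` {..8})). baecklund w) \<and>
    (\<exists>\<phi> \<in> iso W_E8 (subgroup_generated Aut (s ` {..8})). \<forall>i\<le>8. \<phi> (W_gen i) = s i)"
  using ex1_acts_as_listed baecklund_s s_comp_s s_order_3 s_order_2 baecklund_generated iso_W_E8
  by (intro conjI allI impI ballI) simp_all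

end
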